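(* There exists an absolute constant $C>0$ such that: (i) for every integer $n\ge1$ and every $p\ge2$, $B_p^n$ is a $\psi_2$-body with constant $C$; (ii) for every integer $n\ge1$ and every $p\in[1,2]$, $B_p^n$ is a $\psi_p$-body with constant $C$.
   Context: $B_p^n=\{x\in\mathbb{R}^n:\sum_{i=1}^n|x_i|^p\le1\}$. For $\alpha\in[1,2]$, a probability measure $\mu$ on $\mathbb{R}^n$ and measurable $f:\mathbb{R}^n\to\mathbb{R}$, let $\|f\|_{\psi_\alpha(\mu)}=\inf\{\lambda>0:\int e^{|f/\lambda|^\alpha}\,d\mu\le2\}$. A vector $\theta\in S^{n-1}$ (Euclidean unit sphere) defines a $\psi_\alpha$-direction for $\mu$ with constant $C>0$ if the function $f_\theta(x)=\langle x,\theta\rangle$ satisfies $\|f_\theta\|_{\psi_\alpha(\mu)}\le C(\int|f_\theta|^2\,d\mu)^{1/2}$. A convex body $K\subset\mathbb{R}^n$ with center of mass at the origin is a $\psi_\alpha$-body with constant $C$ if every $\theta\in S^{n-1}$ is a $\psi_\alpha$-direction with constant $C$ for the uniform probability measure on $K$. *)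

theory Defs
  imports "HOL-Analysis.Analysis"
begin

(* R^n is modelled by the extensional functions {..<n} ->E UNIV rather than by a type real ^ 'n,
   because a constant independent of the dimension has to be chosen before n is quantified.
   This carrier is both the space of the product measure Rn_lebesgue n and the topspace of
   powertop_real {..<n}. *)

definition Rn :: "nat \<Rightarrow> (nat \<Rightarrow> real) set" where
  "Rn n = ({..<n} \<rightarrow>\<^sub>E UNIV)"

definition Rn_lebesgue :: "nat \<Rightarrow> (nat \<Rightarrow> real) measure" where
  "Rn_lebesgue n = Pi\<^sub>M {..<n} (\<lambda>_. lborel)"

definition Rn_inner :: "nat \<Rightarrow> (nat \<Rightarrow> real) \<Rightarrow> (nat \<Rightarrow> real) \<Rightarrow> real" where
  "Rn_inner n x y = (\<Sum>i<n. x i * y i)"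

definition Rn_unit_sphere :: "nat \<Rightarrow> (nat \<Rightarrow> real) set" where
  "Rn_unit_sphere n = {\<theta> \<in> Rn n. sqrt (Rn_inner n \<theta> \<theta>) = 1}"

definition Rn_convex :: "nat \<Rightarrow> (nat \<Rightarrow> real) set \<Rightarrow> bool" where
  "Rn_convex n K \<longleftrightarrow>
     (\<forall>x\<in>K. \<forall>y\<in>K. \<forall>u\<ge>0. \<forall>v\<ge>0. u + v = 1 \<longrightarrow> (\<lambda>i\<in>{..<n}. u * x i + v * y i) \<in> K)"

definition convex_body :: "nat \<Rightarrow> (nat \<Rightarrow> real) set \<Rightarrow> bool" where
  "convex_body n K \<longleftrightarrow>
     Rn_convex n K \<and>
     compactin (powertop_real {..<n}) K \<and>
     (powertop_real {..<n}) interior_of K \<noteq> {}"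

definition uniform_on_body :: "nat \<Rightarrow> (nat \<Rightarrow> real) set \<Rightarrow> (nat \<Rightarrow> real) measure" where
  "uniform_on_body n K = uniform_measure (Rn_lebesgue n) K"

definition centered :: "nat \<Rightarrow> (nat \<Rightarrow> real) set \<Rightarrow> bool" where
  "centered n K \<longleftrightarrow> (\<forall>i<n. (\<integral>x. x i \<partial>(uniform_on_body n K)) = 0)"

definition Lp_ball :: "nat \<Rightarrow> real \<Rightarrow> (nat \<Rightarrow> real) set" where
  "Lp_ball n p = {x \<in> Rn n. (\<Sum>i<n. \<bar>x i\<bar> powr p) \<le> 1}"

(* Valued in ennreal: the infimum is \<infinity> when no r is admissible, and a divergent
   exponential moment exceeds 2 instead of defaulting to 0. *)
definition psi_norm :: "real \<Rightarrow> 'a measure \<Rightarrow> ('a \<Rightarrow> real) \<Rightarrow> ennreal" where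
  "psi_norm \<alpha> \<mu> f =
     Inf (ennreal ` {r. 0 < r \<and> (\<integral>\<^sup>+ x. ennreal (exp (\<bar>f x / r\<bar> powr \<alpha>)) \<partial>\<mu>) \<le> 2})"

definition L2_norm :: "'a measure \<Rightarrow> ('a \<Rightarrow> real) \<Rightarrow> ennreal" where
  "L2_norm \<mu> f =
     (if integrable \<mu> (\<lambda>x. \<bar>f x\<bar>\<^sup>2) then ennreal (sqrt (\<integral>x. \<bar>f x\<bar>\<^sup>2 \<partial>\<mu>)) else \<infinity>)"

definition psi_direction ::
    "nat \<Rightarrow> real \<Rightarrow> real \<Rightarrow> (nat \<Rightarrow> real) measure \<Rightarrow> (nat \<Rightarrow> real) \<Rightarrow> bool" where
  "psi_direction n \<alpha> C \<mu> \<theta> \<longleftrightarrow>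
     psi_norm \<alpha> \<mu> (\<lambda>x. Rn_inner n x \<theta>) \<le> ennreal C * L2_norm \<mu> (\<lambda>x. Rn_inner n x \<theta>)"

definition psi_body :: "nat \<Rightarrow> real \<Rightarrow> real \<Rightarrow> (nat \<Rightarrow> real) set \<Rightarrow> bool" where
  "psi_body n \<alpha> C K \<longleftrightarrow>
     convex_body n K \<and> centered n K \<and>
     (\<forall>\<theta>\<in>Rn_unit_sphere n. psi_direction n \<alpha> C (uniform_on_body n K) \<theta>)"

end

theory Submission
  imports Defs
begin

text \<open>Put the density \<open>exp (- (\<Sum>i<n. \<bar>x i\<bar> powr p))\<close> on \<open>\<real>\<^sup>n\<close>. Integrating over its level sets shows that
  a random vector with this (normalised) density is distributed as \<open>R \<cdot> X\<close> with \<open>X\<close> uniform on the ball and \<open>R\<^sup>p\<close>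
  an independent gamma variable of parameter \<open>n / p + 1\<close>. Let \<open>f\<close> be a linear functional given by
  a unit vector and \<open>\<alpha> = min p 2\<close>. By Jensen's inequality in \<open>R\<close>, \<open>E exp (\<bar>f(RX) / \<lambda>\<bar>\<^sup>\<alpha>)\<close> dominates
  \<open>E exp (E(R\<^sup>\<alpha>) \<bar>f(X) / \<lambda>\<bar>\<^sup>\<alpha>)\<close>, while \<open>E f(RX)\<^sup>2 = E(R\<^sup>2) E f(X)\<^sup>2\<close>; since \<open>E(R\<^sup>2) \<le> 2 E(R\<^sup>\<alpha>)\<^bsup>2/\<alpha>\<^esup>\<close>, it
  suffices to treat \<open>RX\<close>. Its coordinates are independent, so its Laplace transform factorises, and the
  one-dimensional bounds combine because \<open>\<Sum>\<theta>\<^sub>i\<^sup>2 = 1\<close>; summing Chernoff bounds over integer layers of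
  \<open>\<bar>f\<bar>\<close> gives the exponential moment.\<close>

section \<open>Convex geometry and centring of the balls\<close>

text \<open>Convexity is applied only at strictly positive points; if one point is 0, the inequality
  reduces to c powr p <= c for 0 <= c <= 1.\<close>

lemma powr_convex_nonneg:
  fixes x y u v p :: real
  assumes p: "1 \<le> p" and nn: "0 \<le> x" "0 \<le> y" "0 \<le> u" "0 \<le> v" and uv: "u + v = 1"
  shows "(u * x + v * y) powr p \<le> u * x powr p + v * y powr p"
proof -
  have scale: "(c * z) powr p \<le> c * z powr p" if "0 \<le> c" "c \<le> 1" "0 \<le> z" for c z :: real
  proof (cases "c = 0")
    case False
    have "c powr p \<le> c powr 1"
      using that p by (intro powr_mono') auto
    then have "c powr p * z powr p \<le> c * z powr p"
      using that False by (intro mult_right_mono) auto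
    then show ?thesis
      using that by (simp add: powr_mult)
  qed auto
  consider "x = 0" | "y = 0" | "0 < x" "0 < y"
    using nn by linarith
  then show ?thesis
  proof cases
    case 1
    then show ?thesis
      using scale[of v y] assms by simp
  next
    case 2
    then show ?thesis
      using scale[of u x] assms by simp
  next
    case 3
    then show ?thesis
      using powr_convex[OF p] nn uv by (auto simp: convex_on_def)
  qed
qed

lemma Lp_ball_convex:
  assumes p: "1 \<le> p"
  shows "Rn_convex n (Lp_ball n p)"
  unfolding Rn_convex_def
proof (intro ballI allI impI)
  fix x y u v
  assume x: "x \<in> Lp_ball n p" and y: "y \<in> Lp_ball n p"
    and uv: "0 \<le> u" "0 \<le> v" "u + v = (1::real)"
  have "(\<Sum>i<n. \<bar>u * x i + v * y i\<bar> powr p) \<le> (\<Sum>i<n. u * \<bar>x i\<bar> powr p + v * \<bar>y i\<bar> powr p)"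
  proof (rule sum_mono)
    fix i
    have "\<bar>u * x i + v * y i\<bar> \<le> u * \<bar>x i\<bar> + v * \<bar>y i\<bar>"
      using uv by (metis abs_mult abs_of_nonneg abs_triangle_ineq)
    then have "\<bar>u * x i + v * y i\<bar> powr p \<le> (u * \<bar>x i\<bar> + v * \<bar>y i\<bar>) powr p"
      using p by (intro powr_mono2) auto
    also have "\<dots> \<le> u * \<bar>x i\<bar> powr p + v * \<bar>y i\<bar> powr p"
      using p uv by (intro powr_convex_nonneg) auto
    finally show "\<bar>u * x i + v * y i\<bar> powr p \<le> u * \<bar>x i\<bar> powr p + v * \<bar>y i\<bar> powr p" .
  qed
  also have "\<dots> = u * (\<Sum>i<n. \<bar>x i\<bar> powr p) + v * (\<Sum>i<n. \<bar>y i\<bar> powr p)"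
    by (simp add: sum.distrib sum_distrib_left)
  also have "\<dots> \<le> u * 1 + v * 1"
    using x y uv by (intro add_mono mult_left_mono) (auto simp: Lp_ball_def)
  finally show "(\<lambda>i\<in>{..<n}. u * x i + v * y i) \<in> Lp_ball n p"
    using uv by (simp add: Lp_ball_def Rn_def)
qed

lemma Lp_ball_subset_cube:
  assumes p: "0 < p"
  shows "Lp_ball n p \<subseteq> {..<n} \<rightarrow>\<^sub>E {-1..1}"
proof
  fix x assume x: "x \<in> Lp_ball n p"
  have "\<bar>x i\<bar> \<le> 1" if "i < n" for i
  proof -
    have "\<bar>x i\<bar> powr p \<le> (\<Sum>i<n. \<bar>x i\<bar> powr p)"
      using that by (intro member_le_sum) auto
    also have "\<dots> \<le> 1"
      using x by (simp add: Lp_ball_def)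
    finally show ?thesis
      using p by (meson abs_ge_zero gr_one_powr not_le)
  qed
  moreover have "x \<in> {..<n} \<rightarrow>\<^sub>E UNIV"
    using x by (simp add: Lp_ball_def Rn_def)
  ultimately show "x \<in> {..<n} \<rightarrow>\<^sub>E {-1..1}"
    by (auto simp: PiE_iff abs_le_iff minus_le_iff)
qed

text \<open>The cube is compact as a product of compact intervals, and the ball is closed in it
  because the sum of powers is continuous.\<close>

lemma Lp_ball_compact:
  assumes p: "0 < p"
  shows "compactin (powertop_real {..<n}) (Lp_ball n p)"
proof (rule closed_compactin[OF _ Lp_ball_subset_cube[OF p]])
  show "compactin (powertop_real {..<n}) ({..<n} \<rightarrow>\<^sub>E {-1..1})"
    unfolding compactin_PiE by simp
  have "continuous_map (powertop_real {..<n}) euclideanreal (\<lambda>x. \<Sum>i<n. \<bar>x i\<bar> powr p)"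
  proof (intro continuous_map_sum)
    fix i assume i: "i \<in> {..<n}"
    have "continuous_map euclideanreal euclideanreal (\<lambda>t. \<bar>t\<bar> powr p)"
      using p by (auto intro!: continuous_intros continuous_on_powr')
    from continuous_map_compose[OF continuous_map_product_projection[OF i] this]
    show "continuous_map (powertop_real {..<n}) euclideanreal (\<lambda>x. \<bar>x i\<bar> powr p)"
      by (simp add: o_def)
  qed auto
  from closedin_continuous_map_preimage[OF this, of "{..1}"]
  show "closedin (powertop_real {..<n}) (Lp_ball n p)"
    by (simp add: Lp_ball_def Rn_def)
qed

lemma Lp_ball_interior_nonempty:
  assumes p: "1 \<le> p" and n: "1 \<le> n"
  shows "(powertop_real {..<n}) interior_of (Lp_ball n p) \<noteq> {}"
proof -
  \<comment> \<open>On this cube |x i| powr p <= |x i| <= 1 / n, so the n terms sum to at most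
    1.\<close>
  let ?U = "{..<n} \<rightarrow>\<^sub>E {- 1 / real n <..< 1 / real n}"
  have "openin (powertop_real {..<n}) ?U"
    by (subst openin_PiE) auto
  moreover have "?U \<subseteq> Lp_ball n p"
  proof
    fix x assume x: "x \<in> ?U"
    have "\<bar>x i\<bar> powr p \<le> 1 / real n" if "i < n" for i
    proof -
      have i: "\<bar>x i\<bar> \<le> 1 / real n"
        using PiE_mem[OF x, of i] that by (auto simp: abs_le_iff minus_le_iff)
      moreover have "1 / real n \<le> 1"
        using n by simp
      ultimately have "\<bar>x i\<bar> powr p \<le> \<bar>x i\<bar> powr 1"
        using p by (intro powr_mono') auto
      with i show ?thesis by simp
    qed
    then have "(\<Sum>i<n. \<bar>x i\<bar> powr p) \<le> (\<Sum>i<n. 1 / real n)"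
      by (intro sum_mono) auto
    with x n show "x \<in> Lp_ball n p"
      by (auto simp: Lp_ball_def Rn_def PiE_iff)
  qed
  moreover have "(\<lambda>i\<in>{..<n}. 0) \<in> ?U"
    using n by auto
  ultimately show ?thesis
    using interior_of_maximal by (metis empty_iff subset_empty)
qed

lemma Lp_ball_convex_body:
  assumes "1 \<le> p" "1 \<le> n"
  shows "convex_body n (Lp_ball n p)"
  using assms Lp_ball_convex Lp_ball_compact[of p n] Lp_ball_interior_nonempty
  by (auto simp: convex_body_def)

section \<open>Lebesgue measure under dilations and reflection\<close>

interpretation lborel_product: product_sigma_finite "\<lambda>_::nat. lborel :: real measure"
  by standard

lemma sets_Rn_lebesgue [measurable_cong]:
  "sets (Rn_lebesgue n) = sets (Pi\<^sub>M {..<n} (\<lambda>_. borel))"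
  by (auto simp: Rn_lebesgue_def cong: sets_PiM_cong)

lemma space_Rn_lebesgue: "space (Rn_lebesgue n) = Rn n"
  by (simp add: Rn_lebesgue_def space_PiM Rn_def)

lemma sigma_finite_Rn_lebesgue: "sigma_finite_measure (Rn_lebesgue n)"
  unfolding Rn_lebesgue_def by (rule lborel_product.sigma_finite) simp

definition Rn_scale :: "nat \<Rightarrow> real \<Rightarrow> (nat \<Rightarrow> real) \<Rightarrow> nat \<Rightarrow> real" where
  "Rn_scale n c x = (\<lambda>i\<in>{..<n}. c * x i)"

lemma measurable_Rn_scale [measurable (raw)]:
  assumes [measurable]: "f \<in> borel_measurable N" and g: "g \<in> measurable N (Rn_lebesgue n)"
  shows "(\<lambda>z. Rn_scale n (f z) (g z)) \<in> measurable N (Rn_lebesgue n)"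
proof -
  have [measurable]: "(\<lambda>z. g z i) \<in> borel_measurable N" if "i \<in> {..<n}" for i
    using measurable_compose[OF g[unfolded Rn_lebesgue_def] measurable_component_singleton[OF that]]
    by simp
  show ?thesis
    unfolding Rn_scale_def by measurable
qed

text \<open>A product measure is determined by its values on boxes, and there the claim is the
  one-dimensional scaling law, used once per coordinate.\<close>

lemma Rn_lebesgue_scale:
  assumes c: "c \<noteq> 0"
  shows "Rn_lebesgue n = density (distr (Rn_lebesgue n) (Rn_lebesgue n) (Rn_scale n c)) (\<lambda>_. ennreal (\<bar>c\<bar> ^ n))"
  (is "_ = ?D")
proof -
  have "?D = Pi\<^sub>M {..<n} (\<lambda>_. lborel)"
  proof (rule lborel_product.PiM_eqI)
    fix A :: "nat \<Rightarrow> real set"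
    assume A: "\<And>i. i \<in> {..<n} \<Longrightarrow> A i \<in> sets lborel"
    let ?A = "Pi\<^sub>E {..<n} A" and ?B = "Pi\<^sub>E {..<n} (\<lambda>i. (*) c -` A i)"
    have Bi: "(*) c -` A i \<in> sets lborel" if "i \<in> {..<n}" for i
      using A[OF that] measurable_sets[of "(*) c" borel borel "A i"] by simp
    have sets_A: "?A \<in> sets (Rn_lebesgue n)"
      unfolding Rn_lebesgue_def using A by (intro sets_PiM_I_finite) auto
    have pre: "Rn_scale n c -` ?A \<inter> space (Rn_lebesgue n) = ?B"
      by (auto simp: Rn_scale_def space_Rn_lebesgue Rn_def PiE_iff)
    have one: "emeasure lborel (A i) = ennreal \<bar>c\<bar> * emeasure lborel ((*) c -` A i)"
      if "i \<in> {..<n}" for i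
    proof -
      have "emeasure lborel (A i) = emeasure (density (distr lborel borel ((*) c)) (\<lambda>_. ennreal \<bar>c\<bar>)) (A i)"
        using lborel_distr_mult'[OF c] by metis
      also have "\<dots> = ennreal \<bar>c\<bar> * emeasure lborel ((*) c -` A i)"
        using A[OF that] by (simp add: emeasure_density_const emeasure_distr)
      finally show ?thesis .
    qed
    have "emeasure ?D ?A = ennreal (\<bar>c\<bar> ^ n) * emeasure (Rn_lebesgue n) ?B"
      using sets_A by (simp add: emeasure_density_const emeasure_distr pre)
    also have "emeasure (Rn_lebesgue n) ?B = (\<Prod>i<n. emeasure lborel ((*) c -` A i))"
      unfolding Rn_lebesgue_def using Bi by (intro lborel_product.emeasure_PiM) auto
    also have "ennreal (\<bar>c\<bar> ^ n) * \<dots> = (\<Prod>i<n. ennreal \<bar>c\<bar> * emeasure lborel ((*) c -` A i))"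
      by (simp add: prod.distrib ennreal_power)
    also have "\<dots> = (\<Prod>i<n. emeasure lborel (A i))"
      using one by (intro prod.cong) auto
    finally show "emeasure ?D ?A = (\<Prod>i<n. emeasure lborel (A i))" .
  qed (auto simp: Rn_lebesgue_def)
  then show ?thesis
    by (simp add: Rn_lebesgue_def)
qed

lemma nn_integral_Rn_scale:
  assumes c: "c \<noteq> 0" and [measurable]: "f \<in> borel_measurable (Rn_lebesgue n)"
  shows "(\<integral>\<^sup>+x. f x \<partial>Rn_lebesgue n)
    = ennreal (\<bar>c\<bar> ^ n) * (\<integral>\<^sup>+x. f (Rn_scale n c x) \<partial>Rn_lebesgue n)"
  by (subst Rn_lebesgue_scale[OF c])
     (simp add: nn_integral_density nn_integral_distr nn_integral_cmult)

lemma Lp_ball_measurable [measurable]: "Lp_ball n p \<in> sets (Rn_lebesgue n)"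
proof -
  have "Lp_ball n p = {x \<in> space (Rn_lebesgue n). (\<Sum>i<n. \<bar>x i\<bar> powr p) \<le> 1}"
    by (simp add: Lp_ball_def space_Rn_lebesgue)
  also have "\<dots> \<in> sets (Rn_lebesgue n)"
    by measurable
  finally show ?thesis .
qed

text \<open>The reflection x -> -x preserves Lebesgue measure and the ball, hence the uniform
  measure, so every coordinate mean equals its own negative.\<close>

lemma Lp_ball_centered: "centered n (Lp_ball n p)"
  unfolding centered_def
proof (intro allI impI)
  fix i assume i: "i < n"
  let ?U = "uniform_on_body n (Lp_ball n p)" and ?M = "Rn_lebesgue n"
  let ?s = "Rn_scale n (- 1)"
  let ?g = "\<lambda>x. indicator (Lp_ball n p) x / emeasure ?M (Lp_ball n p)"
  have inv: "distr ?M ?M ?s = ?M"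
    using Rn_lebesgue_scale[of "-1" n] by (simp add: density_1)
  have "?U = density (distr ?M ?M ?s) ?g"
    by (simp add: uniform_on_body_def uniform_measure_def inv)
  also have "\<dots> = distr (density ?M (?g \<circ> ?s)) ?M ?s"
    by (subst density_distr) (auto simp: o_def)
  also have "density ?M (?g \<circ> ?s) = ?U"
    unfolding uniform_on_body_def uniform_measure_def
    by (intro density_cong AE_I2)
       (auto simp: o_def space_Rn_lebesgue Lp_ball_def Rn_def Rn_scale_def indicator_def)
  finally have "(\<integral>x. x i \<partial>?U) = (\<integral>x. x i \<partial>distr ?U ?M ?s)"
    by simp
  also have "\<dots> = (\<integral>x. ?s x i \<partial>?U)"
    using i by (intro integral_distr) (auto simp: uniform_on_body_def)
  also have "\<dots> = - (\<integral>x. x i \<partial>?U)"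
    using i by (simp add: Rn_scale_def)
  finally show "(\<integral>x. x i \<partial>?U) = 0"
    by simp
qed

section \<open>Level sets of the exponential density\<close>

definition Lp_weight :: "nat \<Rightarrow> real \<Rightarrow> (nat \<Rightarrow> real) \<Rightarrow> ennreal" where
  "Lp_weight n p x = ennreal (exp (- (\<Sum>i<n. \<bar>x i\<bar> powr p)))"

text \<open>The unnormalised gamma density of parameter a + 1. Restricting to 0 < t keeps the
  dilation factor t powr (1 / p) nonzero.\<close>

definition gamma_weight :: "real \<Rightarrow> real \<Rightarrow> ennreal" where
  "gamma_weight a t = ennreal (t powr a * exp (- t)) * indicator {0<..} t"

lemma measurable_Rn_component [measurable (raw)]:
  "(\<lambda>x. x i) \<in> borel_measurable (Rn_lebesgue n)" if "i < n"
  using measurable_component_singleton[of i "{..<n}" "\<lambda>_. lborel"] that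
  by (simp add: Rn_lebesgue_def)

lemma Lp_weight_measurable [measurable]: "Lp_weight n p \<in> borel_measurable (Rn_lebesgue n)"
  unfolding Lp_weight_def by measurable

lemma gamma_weight_measurable [measurable]: "gamma_weight a \<in> borel_measurable lborel"
  unfolding gamma_weight_def by measurable

text \<open>This is the integral of exp (- t) over t >= s. Writing the constraint as an indicator of
  t - s keeps it jointly measurable when s depends on x; the excluded point t = 0 is null.\<close>

lemma exp_minus_layer_cake:
  fixes s :: real
  assumes s: "0 \<le> s"
  shows "ennreal (exp (- s)) = (\<integral>\<^sup>+t. ennreal (exp (- t)) * indicator {0<..} t * indicator {0..} (t - s) \<partial>lborel)"
proof -
  have "(\<integral>\<^sup>+t. ennreal (exp (- t)) * indicator {s..} t \<partial>lborel) = ennreal (0 - (- exp (- s)))"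
  proof (rule nn_integral_FTC_atLeast)
    show "((\<lambda>t::real. - exp (- t)) \<longlongrightarrow> 0) at_top"
      using tendsto_minus[OF filterlim_compose[OF exp_at_bot filterlim_uminus_at_bot_at_top]]
      unfolding minus_zero .
  qed (auto intro!: derivative_eq_intros)
  moreover have "(\<integral>\<^sup>+t. ennreal (exp (- t)) * indicator {0<..} t * indicator {0..} (t - s) \<partial>lborel)
      = (\<integral>\<^sup>+t. ennreal (exp (- t)) * indicator {s..} t \<partial>lborel)"
  proof (rule nn_integral_cong_AE)
    show "AE t in lborel. ennreal (exp (- t)) * indicator {0<..} t * indicator {0..} (t - s)
        = ennreal (exp (- t)) * indicator {s..} t"
      using AE_lborel_singleton[of 0]
      by eventually_elim (use s in \<open>auto simp: indicator_def\<close>)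
  qed
  ultimately show ?thesis by simp
qed

lemma Rn_scale_Lp_sum:
  assumes "0 < p" "0 < t"
  shows "(\<Sum>i<n. \<bar>Rn_scale n (t powr (1 / p)) x i\<bar> powr p) = t * (\<Sum>i<n. \<bar>x i\<bar> powr p)"
  using assms by (simp add: Rn_scale_def abs_mult powr_mult powr_powr sum_distrib_left)

text \<open>Cavalieri's principle for the level sets of the weight: its sublevel sets are dilates of
  the ball, so that the weighted integral is a gamma mixture of integrals over the ball.\<close>

lemma nn_integral_Lp_weight:
  assumes p: "0 < p" and [measurable]: "\<phi> \<in> borel_measurable (Rn_lebesgue n)"
  shows "(\<integral>\<^sup>+x. \<phi> x * Lp_weight n p x \<partial>Rn_lebesgue n)
    = (\<integral>\<^sup>+x. indicator (Lp_ball n p) x *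
        (\<integral>\<^sup>+t. gamma_weight (n / p) t * \<phi> (Rn_scale n (t powr (1 / p)) x) \<partial>lborel) \<partial>Rn_lebesgue n)"
proof -
  let ?M = "Rn_lebesgue n"
  let ?S = "\<lambda>x. \<Sum>i<n. \<bar>x i\<bar> powr p"
  interpret P: pair_sigma_finite lborel ?M
    by (intro pair_sigma_finite.intro sigma_finite_lborel sigma_finite_Rn_lebesgue)
  have S_nn: "0 \<le> ?S x" for x by (intro sum_nonneg) auto
  \<comment> \<open>For fixed t the sublevel set is the ball dilated by t powr (1 / p), and the
    substitution contributes the Jacobian t powr (n / p).\<close>
  have inner: "(\<integral>\<^sup>+x. \<phi> x * indicator {0..} (t - ?S x) \<partial>?M)
      = ennreal (t powr (n / p)) * (\<integral>\<^sup>+x. \<phi> (Rn_scale n (t powr (1 / p)) x) * indicator (Lp_ball n p) x \<partial>?M)"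
    if t: "0 < t" for t
  proof -
    have c: "\<bar>t powr (1 / p)\<bar> ^ n = t powr (n / p)"
      using t by (simp add: powr_realpow[symmetric] powr_powr)
    have "(\<integral>\<^sup>+x. \<phi> x * indicator {0..} (t - ?S x) \<partial>?M)
      = ennreal (t powr (n / p)) * (\<integral>\<^sup>+x. \<phi> (Rn_scale n (t powr (1 / p)) x) *
          indicator {0..} (t - ?S (Rn_scale n (t powr (1 / p)) x)) \<partial>?M)"
      using nn_integral_Rn_scale[of "t powr (1 / p)" "\<lambda>x. \<phi> x * indicator {0..} (t - ?S x)" n] t
      unfolding c by simp
    also have "(\<integral>\<^sup>+x. \<phi> (Rn_scale n (t powr (1 / p)) x) *
          indicator {0..} (t - ?S (Rn_scale n (t powr (1 / p)) x)) \<partial>?M)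
        = (\<integral>\<^sup>+x. \<phi> (Rn_scale n (t powr (1 / p)) x) * indicator (Lp_ball n p) x \<partial>?M)"
      unfolding Rn_scale_Lp_sum[OF p t] using t
      by (intro nn_integral_cong) (auto simp: indicator_def Lp_ball_def space_Rn_lebesgue)
    finally show ?thesis .
  qed
  have "(\<integral>\<^sup>+x. \<phi> x * Lp_weight n p x \<partial>?M)
      = (\<integral>\<^sup>+x. (\<integral>\<^sup>+t. \<phi> x * (ennreal (exp (- t)) * indicator {0<..} t * indicator {0..} (t - ?S x)) \<partial>lborel) \<partial>?M)"
  proof (rule nn_integral_cong)
    fix x
    show "\<phi> x * Lp_weight n p x
        = (\<integral>\<^sup>+t. \<phi> x * (ennreal (exp (- t)) * indicator {0<..} t * indicator {0..} (t - ?S x)) \<partial>lborel)"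
      unfolding Lp_weight_def exp_minus_layer_cake[OF S_nn]
      by (rule nn_integral_cmult[symmetric]) measurable
  qed
  also have "\<dots> = (\<integral>\<^sup>+t. (\<integral>\<^sup>+x. \<phi> x * (ennreal (exp (- t)) * indicator {0<..} t * indicator {0..} (t - ?S x)) \<partial>?M) \<partial>lborel)"
    by (rule P.Fubini') measurable
  also have "\<dots> = (\<integral>\<^sup>+t. (\<integral>\<^sup>+x. gamma_weight (n / p) t * \<phi> (Rn_scale n (t powr (1 / p)) x)
      * indicator (Lp_ball n p) x \<partial>?M) \<partial>lborel)"
  proof (rule nn_integral_cong)
    fix t :: real
    have "(\<integral>\<^sup>+x. \<phi> x * (ennreal (exp (- t)) * indicator {0<..} t * indicator {0..} (t - ?S x)) \<partial>?M)
      = (\<integral>\<^sup>+x. ennreal (exp (- t)) * indicator {0<..} t * (\<phi> x * indicator {0..} (t - ?S x)) \<partial>?M)"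
      by (simp only: mult_ac)
    also have "\<dots> = ennreal (exp (- t)) * indicator {0<..} t * (\<integral>\<^sup>+x. \<phi> x * indicator {0..} (t - ?S x) \<partial>?M)"
      by (rule nn_integral_cmult) measurable
    also have "\<dots> = gamma_weight (n / p) t *
        (\<integral>\<^sup>+x. \<phi> (Rn_scale n (t powr (1 / p)) x) * indicator (Lp_ball n p) x \<partial>?M)"
      by (cases "0 < t") (auto simp: inner gamma_weight_def ennreal_mult ac_simps)
    also have "\<dots> = (\<integral>\<^sup>+x. gamma_weight (n / p) t * \<phi> (Rn_scale n (t powr (1 / p)) x)
      * indicator (Lp_ball n p) x \<partial>?M)"
      unfolding mult.assoc by (rule nn_integral_cmult[symmetric]) measurable
    finally show "(\<integral>\<^sup>+x. \<phi> x * (ennreal (exp (- t)) * indicator {0<..} t * indicator {0..} (t - ?S x)) \<partial>?M)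
      = (\<integral>\<^sup>+x. gamma_weight (n / p) t * \<phi> (Rn_scale n (t powr (1 / p)) x)
      * indicator (Lp_ball n p) x \<partial>?M)" .
  qed
  \<comment> \<open>Tonelli again: t becomes the inner variable, so that radial averages can be
    treated separately for each x in the ball.\<close>
  also have "\<dots> = (\<integral>\<^sup>+x. (\<integral>\<^sup>+t. gamma_weight (n / p) t * \<phi> (Rn_scale n (t powr (1 / p)) x)
      * indicator (Lp_ball n p) x \<partial>lborel) \<partial>?M)"
    by (rule P.Fubini'[symmetric]) measurable
  also have "\<dots> = (\<integral>\<^sup>+x. indicator (Lp_ball n p) x *
        (\<integral>\<^sup>+t. gamma_weight (n / p) t * \<phi> (Rn_scale n (t powr (1 / p)) x) \<partial>lborel) \<partial>?M)"
  proof (rule nn_integral_cong)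
    fix x assume [measurable]: "x \<in> space ?M"
    show "(\<integral>\<^sup>+t. gamma_weight (n / p) t * \<phi> (Rn_scale n (t powr (1 / p)) x)
      * indicator (Lp_ball n p) x \<partial>lborel) = indicator (Lp_ball n p) x *
        (\<integral>\<^sup>+t. gamma_weight (n / p) t * \<phi> (Rn_scale n (t powr (1 / p)) x) \<partial>lborel)"
      by (auto simp: indicator_def)
  qed
  finally show ?thesis .
qed

lemma nn_integral_gamma_weight:
  assumes "- 1 < a"
  shows "(\<integral>\<^sup>+t. gamma_weight a t \<partial>lborel) = ennreal (Gamma (a + 1))"
proof -
  have "(\<integral>\<^sup>+t. gamma_weight a t \<partial>lborel)
      = (\<integral>\<^sup>+t. ennreal (t powr (a + 1 - 1) / exp t) * indicator {0..} t \<partial>lborel)"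
  proof (rule nn_integral_cong_AE)
    show "AE t in lborel. gamma_weight a t = ennreal (t powr (a + 1 - 1) / exp t) * indicator {0..} t"
      using AE_lborel_singleton[of 0]
      by eventually_elim (auto simp: gamma_weight_def exp_minus field_simps indicator_def)
  qed
  also have "\<dots> = ennreal (Gamma (a + 1))"
    using assms by (intro nn_integral_has_integral_lebesgue' Gamma_integral_real) auto
  finally show ?thesis .
qed

lemma gamma_weight_times_powr:
  "gamma_weight a t * ennreal (t powr b) = gamma_weight (a + b) t"
  by (cases "0 < t") (auto simp: gamma_weight_def powr_add ennreal_mult ac_simps)

section \<open>One-dimensional estimates\<close>

definition exp_powr_weight :: "real \<Rightarrow> real \<Rightarrow> ennreal" where
  "exp_powr_weight p t = ennreal (exp (- (\<bar>t\<bar> powr p)))"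

text \<open>The normalising constant of one coordinate. It is never evaluated; all estimates are
  relative to it.\<close>

definition exp_powr_mass :: "real \<Rightarrow> ennreal" where
  "exp_powr_mass p = (\<integral>\<^sup>+t. exp_powr_weight p t \<partial>lborel)"

lemma exp_powr_weight_measurable [measurable]: "exp_powr_weight p \<in> borel_measurable borel"
  unfolding exp_powr_weight_def by measurable

text \<open>The weight is even. Adding the reflected integral is how odd terms are cancelled later
  without subtraction in \<open>ennreal\<close>.\<close>

lemma nn_integral_exp_powr_weight_symmetrize:
  assumes [measurable]: "f \<in> borel_measurable borel"
  shows "2 * (\<integral>\<^sup>+t. f t * exp_powr_weight p t \<partial>lborel)
    = (\<integral>\<^sup>+t. (f t + f (- t)) * exp_powr_weight p t \<partial>lborel)"
proof -
  have "(\<integral>\<^sup>+t. f t * exp_powr_weight p t \<partial>lborel) = (\<integral>\<^sup>+t. f (- t) * exp_powr_weight p t \<partial>lborel)"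
    by (subst nn_integral_real_affine[of _ "- 1" 0]) (auto simp: exp_powr_weight_def)
  then show ?thesis
    by (simp add: mult_2 distrib_right nn_integral_add)
qed

lemma powr_le_one_plus_powr:
  fixes x :: real
  assumes "0 \<le> x" "0 \<le> a" "a \<le> b"
  shows "x powr a \<le> 1 + x powr b"
proof (cases "x \<le> 1")
  case True
  then have "x powr a \<le> 1"
    using assms by (intro powr_le1) auto
  then show ?thesis by (simp add: add_increasing2)
next
  case False
  then have "x powr a \<le> x powr b"
    using assms by (intro powr_mono) auto
  then show ?thesis by simp
qed

text \<open>Since |t| <= 1 + |t| powr p, the weight is dominated by e times exp (- |t|), uniformly
  in p.\<close>

lemma exp_powr_mass_less_top:
  assumes p: "1 \<le> p"
  shows "exp_powr_mass p < \<infinity>"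
proof -
  \<comment> \<open>This is the integrand of \<open>exp_minus_layer_cake\<close> at s = 0, so its
    integral is exp 0 = 1.\<close>
  let ?f = "\<lambda>t::real. ennreal (exp (- t)) * indicator {0<..} t * indicator {0..} (t - 0)"
  have I: "(\<integral>\<^sup>+t. ?f t \<partial>lborel) = 1"
    using exp_minus_layer_cake[of 0] by simp
  have "exp_powr_mass p \<le> (\<integral>\<^sup>+t. ennreal (exp 1) * (?f t + ?f (- t)) \<partial>lborel)"
    unfolding exp_powr_mass_def
  proof (rule nn_integral_mono_AE)
    show "AE t in lborel. exp_powr_weight p t \<le> ennreal (exp 1) * (?f t + ?f (- t))"
      using AE_lborel_singleton[of 0]
    proof eventually_elim
      case (elim t)
      have "\<bar>t\<bar> powr 1 \<le> 1 + \<bar>t\<bar> powr p"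
        using p by (intro powr_le_one_plus_powr) auto
      then have "exp (- (\<bar>t\<bar> powr p)) \<le> exp 1 * exp (- \<bar>t\<bar>)"
        by (simp add: mult_exp_exp)
      then have "exp_powr_weight p t \<le> ennreal (exp 1) * ennreal (exp (- \<bar>t\<bar>))"
        unfolding exp_powr_weight_def by (simp add: ennreal_mult'[symmetric])
      also have "ennreal (exp (- \<bar>t\<bar>)) = ?f t + ?f (- t)"
        using elim by (cases "0 < t") auto
      finally show ?case .
    qed
  qed
  also have "\<dots> = ennreal (exp 1) * (1 + (\<integral>\<^sup>+t. ?f (- t) \<partial>lborel))"
    using I by (simp add: nn_integral_cmult nn_integral_add)
  also have "(\<integral>\<^sup>+t. ?f (- t) \<partial>lborel) = 1"
    using nn_integral_real_affine[of ?f "- 1" 0] I by simp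
  also have "ennreal (exp 1) * (1 + 1) < \<infinity>"
    by (simp add: ennreal_mult_less_top)
  finally show ?thesis .
qed

text \<open>On [1/2, 1], an interval of length 1/2, the integrand is at least 1/4 * 1/3, where 1/3
  comes from e <= 3.\<close>

lemma exp_powr_variance_lower_unit:
  assumes p: "1 \<le> p"
  shows "ennreal (1 / 24) \<le> (\<integral>\<^sup>+t. ennreal (t\<^sup>2) * exp_powr_weight p t \<partial>lborel)"
proof -
  have "ennreal (1 / 24) = (\<integral>\<^sup>+t. ennreal (1 / 12) * indicator {1 / 2..1} t \<partial>(lborel :: real measure))"
  proof -
    have "(\<integral>\<^sup>+t. ennreal (1 / 12) * indicator {1 / 2..1} t \<partial>(lborel :: real measure))
        = ennreal (1 / 12) * emeasure lborel {1 / 2..1 :: real}"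
      by (rule nn_integral_cmult_indicator) simp
    also have "emeasure lborel {1 / 2..1 :: real} = ennreal (1 - 1 / 2)"
      by (rule emeasure_lborel_Icc) simp
    also have "ennreal (1 / 12) * ennreal (1 - 1 / 2) = ennreal (1 / 24)"
      by (subst ennreal_mult'[symmetric]) auto
    finally show ?thesis ..
  qed
  also have "\<dots> \<le> (\<integral>\<^sup>+t. ennreal (t\<^sup>2) * exp_powr_weight p t \<partial>lborel)"
  proof (rule nn_integral_mono)
    fix t :: real
    have "1 / 12 \<le> t\<^sup>2 * exp (- (\<bar>t\<bar> powr p))" if t: "1 / 2 \<le> t" "t \<le> 1"
    proof -
      have "\<bar>t\<bar> powr p \<le> 1"
        using t p by (intro powr_le1) auto
      then have "exp (- 1) \<le> exp (- (\<bar>t\<bar> powr p))" by simp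
      moreover have "1 / 3 \<le> exp (- 1 :: real)"
        using exp_le by (simp add: exp_minus field_simps)
      ultimately have "1 / 3 \<le> exp (- (\<bar>t\<bar> powr p))" by linarith
      moreover have "(1 / 2)\<^sup>2 \<le> t\<^sup>2"
        using t by (intro power_mono) auto
      ultimately have "(1 / 2)\<^sup>2 * (1 / 3) \<le> t\<^sup>2 * exp (- (\<bar>t\<bar> powr p))"
        by (intro mult_mono) auto
      then show ?thesis by (simp add: power2_eq_square)
    qed
    then show "ennreal (1 / 12) * indicator {1 / 2..1} t \<le> ennreal (t\<^sup>2) * exp_powr_weight p t"
      by (auto simp: exp_powr_weight_def indicator_def ennreal_mult'[symmetric] intro!: ennreal_leI)
  qed
  finally show ?thesis .
qed

text \<open>Bounds the variance of a normalised coordinate below by 1/49, uniformly in p. Outside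
  [-1, 1] the factor t^2 is at least 1; inside, the mass is at most 2 = 48 * (1/24). Hence 49 = 48 +
  1.\<close>

lemma exp_powr_mass_le_variance:
  assumes p: "1 \<le> p"
  shows "exp_powr_mass p \<le> 49 * (\<integral>\<^sup>+t. ennreal (t\<^sup>2) * exp_powr_weight p t \<partial>lborel)"
    (is "_ \<le> 49 * ?V")
proof -
  have "exp_powr_mass p \<le> (\<integral>\<^sup>+t. indicator {-1..1} t + ennreal (t\<^sup>2) * exp_powr_weight p t \<partial>lborel)"
    unfolding exp_powr_mass_def
  proof (rule nn_integral_mono)
    fix t :: real
    show "exp_powr_weight p t \<le> indicator {-1..1} t + ennreal (t\<^sup>2) * exp_powr_weight p t"
    proof (cases "\<bar>t\<bar> \<le> 1")
      case True
      then have "exp_powr_weight p t \<le> 1"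
        by (simp add: exp_powr_weight_def)
      with True show ?thesis
        by (simp add: indicator_def abs_le_iff minus_le_iff add_increasing2)
    next
      case False
      then have "1 \<le> ennreal (t\<^sup>2)"
        by (metis abs_ge_zero ennreal_1 ennreal_leI less_eq_real_def linorder_not_le one_le_power power2_abs)
      then have "1 * exp_powr_weight p t \<le> ennreal (t\<^sup>2) * exp_powr_weight p t"
        by (rule mult_right_mono) simp
      then show ?thesis by (simp add: add_increasing)
    qed
  qed
  also have "\<dots> = 2 + ?V"
    by (subst nn_integral_add) auto
  also have "2 \<le> 48 * ?V"
  proof -
    have "48 * ennreal (1 / 24) \<le> 48 * ?V"
      by (intro mult_left_mono exp_powr_variance_lower_unit p) simp
    moreover have "48 * ennreal (1 / 24) = 2"
      by (simp flip: ennreal_numeral ennreal_mult')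
    ultimately show ?thesis by simp
  qed
  also have "48 * ?V + ?V = 49 * ?V"
  proof -
    have "48 * ?V + 1 * ?V = (48 + 1) * ?V" by (rule distrib_right[symmetric])
    then show ?thesis by simp
  qed
  finally show ?thesis by (simp add: add_right_mono)
qed

lemma exp_powr_mass_pos:
  assumes p: "1 \<le> p"
  shows "0 < exp_powr_mass p"
proof (rule ccontr)
  assume "\<not> 0 < exp_powr_mass p"
  then have "(\<integral>\<^sup>+t. exp_powr_weight p t \<partial>lborel) = 0"
    by (simp add: exp_powr_mass_def)
  then have "AE t in lborel. exp_powr_weight p t = 0"
    by (simp add: nn_integral_0_iff_AE)
  then have "AE t in (lborel :: real measure). False"
    by eventually_elim (simp add: exp_powr_weight_def)
  then show False
    by (simp add: AE_iff_null null_sets_def)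
qed

text \<open>As |t| powr \<alpha> <= 1 + |t| powr p, the exponential factor costs exp (1/4) <= 3/2
  and a quarter of the decay. Rescaling restores the decay at a cost of at most 4/3, and 3/2 * 4/3 =
  2.\<close>

lemma exp_powr_moment_bound:
  assumes \<alpha>: "0 \<le> \<alpha>" "\<alpha> \<le> p" and p: "1 \<le> p"
  shows "(\<integral>\<^sup>+t. ennreal (exp (\<bar>t\<bar> powr \<alpha> / 4)) * exp_powr_weight p t \<partial>lborel) \<le> 2 * exp_powr_mass p"
proof -
  \<comment> \<open>The dilation by c turns the exponent |t| powr p into 3/4 * |t| powr p; p >= 1
    gives c >= 3/4.\<close>
  define c where "c = (3 / 4) powr (1 / p)"
  have c: "0 < c" "3 / 4 \<le> c"
    using p powr_mono'[of "1 / p" 1 "3 / 4"] by (auto simp: c_def)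
  let ?J = "\<integral>\<^sup>+t. ennreal (exp (- (3 / 4 * \<bar>t\<bar> powr p))) \<partial>lborel"
  have cp: "c powr p = 3 / 4"
    using p by (simp add: c_def powr_powr)
  have "ennreal (3 / 4) * ?J \<le> ennreal \<bar>c\<bar> * ?J"
    using c by (intro mult_right_mono ennreal_leI) auto
  also have "\<dots> = exp_powr_mass p"
    unfolding exp_powr_mass_def
    by (subst nn_integral_real_affine[of _ c 0])
       (use c in \<open>auto simp: exp_powr_weight_def abs_mult powr_mult cp\<close>)
  finally have "ennreal (4 / 3) * (ennreal (3 / 4) * ?J) \<le> ennreal (4 / 3) * exp_powr_mass p"
    by (rule mult_left_mono) simp
  then have J: "?J \<le> ennreal (4 / 3) * exp_powr_mass p"
    by (simp add: mult.assoc[symmetric] ennreal_mult'[symmetric])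
  have "(\<integral>\<^sup>+t. ennreal (exp (\<bar>t\<bar> powr \<alpha> / 4)) * exp_powr_weight p t \<partial>lborel)
      \<le> (\<integral>\<^sup>+t. ennreal (3 / 2) * ennreal (exp (- (3 / 4 * \<bar>t\<bar> powr p))) \<partial>lborel)"
  proof (rule nn_integral_mono)
    fix t :: real
    have "\<bar>t\<bar> powr \<alpha> \<le> 1 + \<bar>t\<bar> powr p"
      using \<alpha> by (intro powr_le_one_plus_powr) auto
    then have "exp (\<bar>t\<bar> powr \<alpha> / 4) * exp (- (\<bar>t\<bar> powr p)) \<le> exp (1 / 4) * exp (- (3 / 4 * \<bar>t\<bar> powr p))"
      by (simp add: mult_exp_exp)
    also have "\<dots> \<le> 3 / 2 * exp (- (3 / 4 * \<bar>t\<bar> powr p))"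
      using exp_bound[of "1 / 4"] by (intro mult_right_mono) (auto simp: power2_eq_square)
    finally show "ennreal (exp (\<bar>t\<bar> powr \<alpha> / 4)) * exp_powr_weight p t
        \<le> ennreal (3 / 2) * ennreal (exp (- (3 / 4 * \<bar>t\<bar> powr p)))"
      by (simp add: exp_powr_weight_def ennreal_mult'[symmetric] ennreal_leI)
  qed
  also have "\<dots> = ennreal (3 / 2) * ?J"
    by (rule nn_integral_cmult) measurable
  also have "\<dots> \<le> ennreal (3 / 2) * (ennreal (4 / 3) * exp_powr_mass p)"
    by (intro mult_left_mono J) simp
  also have "\<dots> = 2 * exp_powr_mass p"
    by (simp add: mult.assoc[symmetric] ennreal_mult'[symmetric])
  finally show ?thesis .
qed

section \<open>Laplace transform of one coordinate\<close>

lemma exp_plus_exp_minus_le: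
  fixes y :: real
  shows "exp y + exp (- y) \<le> 2 + y\<^sup>2 * exp \<bar>y\<bar>"
proof -
  have taylor: "exp x \<le> 1 + x + x\<^sup>2 / 2 * exp \<bar>x\<bar>" for x :: real
  proof -
    obtain t where t: "\<bar>t\<bar> \<le> \<bar>x\<bar>" "exp x = (\<Sum>m<2. x ^ m / fact m) + exp t / fact 2 * x ^ 2"
      using Maclaurin_exp_le[of x 2] by auto
    have "exp t * x\<^sup>2 \<le> exp \<bar>x\<bar> * x\<^sup>2"
      using t by (intro mult_right_mono) auto
    with t show ?thesis
      by (simp add: numeral_2_eq_2 field_simps)
  qed
  \<comment> \<open>The linear terms at y and -y cancel.\<close>
  from taylor[of y] taylor[of "- y"] show ?thesis
    by simp
qed

lemma square_le_exp:
  fixes x :: real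
  assumes "0 \<le> x"
  shows "x\<^sup>2 \<le> 2 * exp x"
  using exp_lower_Taylor_quadratic[OF assms] assms by simp

text \<open>The Gaussian regime: after symmetrisation the first-order term is gone, so the excess
  over the total mass is quadratic in s.\<close>

lemma exp_powr_mgf_small:
  assumes \<alpha>: "1 \<le> \<alpha>" "\<alpha> \<le> p" and s: "\<bar>s\<bar> \<le> 1"
  shows "(\<integral>\<^sup>+t. ennreal (exp (s * t / 8)) * exp_powr_weight p t \<partial>lborel)
    \<le> ennreal (exp (3 * s\<^sup>2)) * exp_powr_mass p" (is "?A \<le> _")
proof -
  have "2 * ?A = (\<integral>\<^sup>+t. (ennreal (exp (s * t / 8)) + ennreal (exp (s * (- t) / 8))) * exp_powr_weight p t \<partial>lborel)"
    by (rule nn_integral_exp_powr_weight_symmetrize) measurable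
  also have "\<dots> \<le> (\<integral>\<^sup>+t. 2 * exp_powr_weight p t
      + ennreal (3 * s\<^sup>2) * (ennreal (exp (\<bar>t\<bar> powr \<alpha> / 4)) * exp_powr_weight p t) \<partial>lborel)"
  proof (rule nn_integral_mono)
    fix t :: real
    define y where "y = s * t / 8"
    have y: "\<bar>y\<bar> \<le> \<bar>t\<bar> / 8"
      using mult_right_mono[OF s, of "\<bar>t\<bar>"] by (simp add: y_def abs_mult)
    have "exp y + exp (- y) \<le> 2 + y\<^sup>2 * exp \<bar>y\<bar>"
      by (rule exp_plus_exp_minus_le)
    also have "y\<^sup>2 * exp \<bar>y\<bar> = s\<^sup>2 * ((\<bar>t\<bar> / 8)\<^sup>2 * exp \<bar>y\<bar>)"
      by (simp add: y_def power_mult_distrib power_divide)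
    \<comment> \<open>\<open>square_le_exp\<close> at |t| / 8 trades the quadratic factor for a
      second exp (|t| / 8). The resulting exponent |t| / 4 is the one that
      \<open>exp_powr_moment_bound\<close> can absorb.\<close>
    also have "\<dots> \<le> s\<^sup>2 * (2 * exp (\<bar>t\<bar> / 8) * exp (\<bar>t\<bar> / 8))"
      using y by (intro mult_left_mono mult_mono square_le_exp) auto
    also have "\<dots> = 2 * s\<^sup>2 * exp (\<bar>t\<bar> / 4)"
      by (simp add: mult_exp_exp)
    also have "\<dots> \<le> 2 * s\<^sup>2 * (3 / 2 * exp (\<bar>t\<bar> powr \<alpha> / 4))"
    proof (intro mult_left_mono)
      have "\<bar>t\<bar> powr 1 \<le> 1 + \<bar>t\<bar> powr \<alpha>"
        using \<alpha> by (intro powr_le_one_plus_powr) auto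
      then have "exp (\<bar>t\<bar> / 4) \<le> exp (1 / 4) * exp (\<bar>t\<bar> powr \<alpha> / 4)"
        by (simp add: mult_exp_exp)
      also have "\<dots> \<le> 3 / 2 * exp (\<bar>t\<bar> powr \<alpha> / 4)"
        using exp_bound[of "1 / 4"] by (intro mult_right_mono) (auto simp: power2_eq_square)
      finally show "exp (\<bar>t\<bar> / 4) \<le> 3 / 2 * exp (\<bar>t\<bar> powr \<alpha> / 4)" .
    qed auto
    finally have "exp y + exp (- y) \<le> 2 + 3 * s\<^sup>2 * exp (\<bar>t\<bar> powr \<alpha> / 4)"
      by simp
    from ennreal_leI[OF this]
    have "ennreal (exp y) + ennreal (exp (- y)) \<le> 2 + ennreal (3 * s\<^sup>2) * ennreal (exp (\<bar>t\<bar> powr \<alpha> / 4))"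
      by (simp add: ennreal_mult')
    from mult_right_mono[OF this, of "exp_powr_weight p t"]
    show "(ennreal (exp (s * t / 8)) + ennreal (exp (s * (- t) / 8))) * exp_powr_weight p t
      \<le> 2 * exp_powr_weight p t + ennreal (3 * s\<^sup>2) * (ennreal (exp (\<bar>t\<bar> powr \<alpha> / 4)) * exp_powr_weight p t)"
      by (simp add: y_def distrib_right mult.assoc)
  qed
  also have "\<dots> = 2 * exp_powr_mass p
      + ennreal (3 * s\<^sup>2) * (\<integral>\<^sup>+t. ennreal (exp (\<bar>t\<bar> powr \<alpha> / 4)) * exp_powr_weight p t \<partial>lborel)"
    by (simp add: nn_integral_add nn_integral_cmult exp_powr_mass_def)
  also have "\<dots> \<le> 2 * exp_powr_mass p + ennreal (3 * s\<^sup>2) * (2 * exp_powr_mass p)"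
    using \<alpha> by (intro add_left_mono mult_left_mono exp_powr_moment_bound) auto
  also have "\<dots> = 2 * ((1 + ennreal (3 * s\<^sup>2)) * exp_powr_mass p)"
    by (simp add: algebra_simps)
  finally have "?A \<le> (1 + ennreal (3 * s\<^sup>2)) * exp_powr_mass p"
    by (subst (asm) ennreal_mult_le_mult_iff) auto
  also have "\<dots> \<le> ennreal (exp (3 * s\<^sup>2)) * exp_powr_mass p"
  proof (rule mult_right_mono)
    have "1 + ennreal (3 * s\<^sup>2) = ennreal (1 + 3 * s\<^sup>2)"
      by simp
    also have "\<dots> \<le> ennreal (exp (3 * s\<^sup>2))"
      by (intro ennreal_leI exp_ge_add_one_self)
    finally show "1 + ennreal (3 * s\<^sup>2) \<le> ennreal (exp (3 * s\<^sup>2))" .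
  qed simp
  finally show ?thesis .
qed

text \<open>The larger of w and t majorises the product. This form of Young's inequality loses a
  constant but includes \<alpha> = 1.\<close>

lemma powr_Young_crude:
  fixes w t :: real
  assumes "1 \<le> \<alpha>" "0 < w" "0 \<le> t"
  shows "w powr (\<alpha> - 1) * t \<le> w powr \<alpha> + t powr \<alpha>"
proof (cases "t \<le> w")
  case True
  then have "w powr (\<alpha> - 1) * t \<le> w powr (\<alpha> - 1) * w"
    by (intro mult_left_mono) auto
  also have "\<dots> = w powr \<alpha>"
    using assms by (simp add: powr_mult_base mult.commute)
  finally show ?thesis by (simp add: add_increasing2)
next
  case False
  then have "w powr (\<alpha> - 1) * t \<le> t powr (\<alpha> - 1) * t"
    using assms by (intro mult_right_mono powr_mono2) auto
  also have "\<dots> = t powr \<alpha>"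
    using False assms by (simp add: powr_mult_base mult.commute)
  finally show ?thesis by (simp add: add_increasing)
qed

text \<open>Young's inequality separates s from t. The factor 2 of the moment bound is absorbed into
  exp (2 * w powr \<alpha>), which is possible because w >= 1.\<close>

lemma exp_powr_mgf_large:
  assumes \<alpha>: "1 \<le> \<alpha>" "\<alpha> \<le> p" and w: "1 \<le> w" and s: "\<bar>s\<bar> = w powr (\<alpha> - 1)"
  shows "(\<integral>\<^sup>+t. ennreal (exp (s * t / 8)) * exp_powr_weight p t \<partial>lborel)
    \<le> ennreal (exp (3 * w powr \<alpha>)) * exp_powr_mass p"
proof -
  have w1: "1 \<le> w powr \<alpha>"
    using w \<alpha> by (intro ge_one_powr_ge_zero) auto
  have "(\<integral>\<^sup>+t. ennreal (exp (s * t / 8)) * exp_powr_weight p t \<partial>lborel)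
      \<le> (\<integral>\<^sup>+t. ennreal (exp (w powr \<alpha>)) * (ennreal (exp (\<bar>t\<bar> powr \<alpha> / 4)) * exp_powr_weight p t) \<partial>lborel)"
  proof (rule nn_integral_mono)
    fix t :: real
    have "s * t \<le> \<bar>s\<bar> * \<bar>t\<bar>"
      by (metis abs_ge_self abs_mult)
    also have "\<dots> \<le> w powr \<alpha> + \<bar>t\<bar> powr \<alpha>"
      unfolding s using \<alpha> w by (intro powr_Young_crude) auto
    finally have "s * t / 8 \<le> w powr \<alpha> + \<bar>t\<bar> powr \<alpha> / 4"
      using w1 powr_ge_zero[of "\<bar>t\<bar>" \<alpha>] by linarith
    then have "exp (s * t / 8) \<le> exp (w powr \<alpha>) * exp (\<bar>t\<bar> powr \<alpha> / 4)"
      by (simp add: mult_exp_exp)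
    from mult_right_mono[OF ennreal_leI[OF this], of "exp_powr_weight p t"]
    show "ennreal (exp (s * t / 8)) * exp_powr_weight p t
        \<le> ennreal (exp (w powr \<alpha>)) * (ennreal (exp (\<bar>t\<bar> powr \<alpha> / 4)) * exp_powr_weight p t)"
      by (simp add: ennreal_mult' mult.assoc)
  qed
  also have "\<dots> = ennreal (exp (w powr \<alpha>)) *
      (\<integral>\<^sup>+t. ennreal (exp (\<bar>t\<bar> powr \<alpha> / 4)) * exp_powr_weight p t \<partial>lborel)"
    by (rule nn_integral_cmult) measurable
  also have "\<dots> \<le> ennreal (exp (w powr \<alpha>)) * (2 * exp_powr_mass p)"
    using \<alpha> by (intro mult_left_mono exp_powr_moment_bound) auto
  also have "\<dots> = ennreal (exp (w powr \<alpha>) * 2) * exp_powr_mass p"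
    by (simp add: ennreal_mult' mult.assoc)
  also have "\<dots> \<le> ennreal (exp (3 * w powr \<alpha>)) * exp_powr_mass p"
  proof (intro mult_right_mono ennreal_leI)
    have "2 \<le> exp (2 * w powr \<alpha>)"
      using exp_ge_add_one_self[of "2 * w powr \<alpha>"] w1 by linarith
    then have "exp (w powr \<alpha>) * 2 \<le> exp (w powr \<alpha>) * exp (2 * w powr \<alpha>)"
      by (intro mult_left_mono) auto
    then show "exp (w powr \<alpha>) * 2 \<le> exp (3 * w powr \<alpha>)"
      by (simp add: mult_exp_exp)
  qed simp
  finally show ?thesis .
qed

text \<open>The dual form of the \<open>\<psi>\<^sub>\<alpha>\<close> estimate: parametrising the Laplace variable as \<open>u powr (\<alpha> - 1)\<close>
  replaces the conjugate exponent, which degenerates at \<open>\<alpha> = 1\<close>.\<close>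

lemma exp_powr_mgf:
  assumes \<alpha>: "1 \<le> \<alpha>" "\<alpha> \<le> 2" "\<alpha> \<le> p" and u: "1 \<le> u" and \<theta>: "\<bar>\<theta>\<bar> \<le> 1"
  shows "(\<integral>\<^sup>+t. ennreal (exp (u powr (\<alpha> - 1) * \<theta> * t / 8)) * exp_powr_weight p t \<partial>lborel)
    \<le> ennreal (exp (3 * u powr \<alpha> * \<theta>\<^sup>2)) * exp_powr_mass p"
proof (cases "\<bar>u powr (\<alpha> - 1) * \<theta>\<bar> \<le> 1")
  case True
  have "(u powr (\<alpha> - 1) * \<theta>)\<^sup>2 = u powr (2 * (\<alpha> - 1)) * \<theta>\<^sup>2"
    using u by (simp add: power_mult_distrib powr_power mult.commute)
  \<comment> \<open>2 * (\<alpha> - 1) <= \<alpha> because \<alpha> <= 2, and u >= 1.\<close>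
  also have "\<dots> \<le> u powr \<alpha> * \<theta>\<^sup>2"
    using \<alpha> u by (intro mult_right_mono powr_mono) auto
  finally have "ennreal (exp (3 * (u powr (\<alpha> - 1) * \<theta>)\<^sup>2)) * exp_powr_mass p
      \<le> ennreal (exp (3 * u powr \<alpha> * \<theta>\<^sup>2)) * exp_powr_mass p"
    by (intro mult_right_mono ennreal_leI) auto
  with exp_powr_mgf_small[OF \<alpha>(1,3) True] show ?thesis
    by (rule order_trans)
next
  case False
  then have \<theta>0: "\<theta> \<noteq> 0" by auto
  \<comment> \<open>At \<alpha> = 1 the Laplace variable would be \<theta> itself, of modulus at
    most 1, which is the first case.\<close>
  have "\<alpha> \<noteq> 1"
    using False \<theta> u by auto
  with \<alpha> have \<alpha>1: "1 < \<alpha>" by simp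
  \<comment> \<open>Chosen to solve w powr (\<alpha> - 1) = u powr (\<alpha> - 1) * |\<theta>|, as
    \<open>exp_powr_mgf_large\<close> requires.\<close>
  define w where "w = u * \<bar>\<theta>\<bar> powr (1 / (\<alpha> - 1))"
  have w_powr: "w powr (\<alpha> - 1) = \<bar>u powr (\<alpha> - 1) * \<theta>\<bar>"
    using \<alpha>1 \<theta>0 u by (simp add: w_def powr_mult powr_powr abs_mult)
  have w: "1 \<le> w"
  proof (rule ccontr)
    assume "\<not> 1 \<le> w"
    then have "w powr (\<alpha> - 1) \<le> 1"
      using \<alpha>1 u by (intro powr_le1) (auto simp: w_def)
    with w_powr False show False by simp
  qed
  have "w powr \<alpha> = u powr \<alpha> * \<bar>\<theta>\<bar> powr (\<alpha> / (\<alpha> - 1))"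
    using u by (simp add: w_def powr_mult powr_powr)
  also have "\<dots> \<le> u powr \<alpha> * \<bar>\<theta>\<bar> powr 2"
  proof (intro mult_left_mono powr_mono')
    \<comment> \<open>The conjugate exponent of \<alpha> <= 2 is at least 2, so for |\<theta>| <= 1
      the power of |\<theta>| is at most its square.\<close>
    show "2 \<le> \<alpha> / (\<alpha> - 1)"
      using \<alpha> \<alpha>1 by (simp add: field_simps)
  qed (use \<theta> in auto)
  also have "\<bar>\<theta>\<bar> powr 2 = \<theta>\<^sup>2"
    using \<theta>0 by simp
  finally have "ennreal (exp (3 * w powr \<alpha>)) * exp_powr_mass p
      \<le> ennreal (exp (3 * u powr \<alpha> * \<theta>\<^sup>2)) * exp_powr_mass p"
    by (intro mult_right_mono ennreal_leI) auto
  with exp_powr_mgf_large[OF \<alpha>(1,3) w w_powr[symmetric]] show ?thesis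
    by (rule order_trans)
qed

section \<open>Linear functionals under the product density\<close>

lemma Lp_weight_eq_prod: "Lp_weight n p x = (\<Prod>i<n. exp_powr_weight p (x i))"
  by (simp add: Lp_weight_def exp_powr_weight_def prod_ennreal exp_sum flip: sum_negf)

lemma Rn_inner_measurable [measurable]:
  "(\<lambda>x. Rn_inner n x \<theta>) \<in> borel_measurable (Rn_lebesgue n)"
  unfolding Rn_inner_def by measurable

lemma nn_integral_exp_inner_Lp_weight:
  "(\<integral>\<^sup>+x. ennreal (exp (Rn_inner n x \<theta>)) * Lp_weight n p x \<partial>Rn_lebesgue n)
    = (\<Prod>i<n. \<integral>\<^sup>+t. ennreal (exp (\<theta> i * t)) * exp_powr_weight p t \<partial>lborel)"
proof -
  have "ennreal (exp (Rn_inner n x \<theta>)) * Lp_weight n p x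
      = (\<Prod>i<n. ennreal (exp (\<theta> i * x i)) * exp_powr_weight p (x i))" for x
    by (simp add: Lp_weight_eq_prod Rn_inner_def prod.distrib prod_ennreal exp_sum mult.commute)
  then show ?thesis
    using lborel_product.product_nn_integral_prod
      [of "{..<n}" "\<lambda>i t. ennreal (exp (\<theta> i * t)) * exp_powr_weight p t"]
    by (simp add: Rn_lebesgue_def)
qed

lemma nn_integral_Lp_weight_mass:
  "(\<integral>\<^sup>+x. Lp_weight n p x \<partial>Rn_lebesgue n) = exp_powr_mass p ^ n"
  using nn_integral_exp_inner_Lp_weight[of n "\<lambda>_. 0" p]
  by (simp add: Rn_inner_def exp_powr_mass_def)

lemma abs_le_one_of_unit:
  assumes "Rn_inner n \<theta> \<theta> = 1" "i < n"
  shows "\<bar>\<theta> i\<bar> \<le> 1"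
proof -
  have "\<theta> i * \<theta> i \<le> (\<Sum>i<n. \<theta> i * \<theta> i)"
    using assms by (intro member_le_sum) auto
  then have "(\<theta> i)\<^sup>2 \<le> 1"
    using assms by (simp add: Rn_inner_def power2_eq_square)
  then show ?thesis
    by (simp add: abs_square_le_1)
qed

text \<open>The one-dimensional exponents are linear in the squared coordinates of \<theta>. They
  add up to 3 * u powr \<alpha> for a unit vector, so n enters only through the total mass.\<close>

lemma Lp_weight_mgf:
  assumes \<alpha>: "1 \<le> \<alpha>" "\<alpha> \<le> 2" "\<alpha> \<le> p" and u: "1 \<le> u" and \<theta>: "Rn_inner n \<theta> \<theta> = 1"
  shows "(\<integral>\<^sup>+x. ennreal (exp (u powr (\<alpha> - 1) * Rn_inner n x \<theta> / 8)) * Lp_weight n p x \<partial>Rn_lebesgue n)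
    \<le> ennreal (exp (3 * u powr \<alpha>)) * exp_powr_mass p ^ n"
proof -
  let ?c = "u powr (\<alpha> - 1)"
  have "(\<integral>\<^sup>+x. ennreal (exp (?c * Rn_inner n x \<theta> / 8)) * Lp_weight n p x \<partial>Rn_lebesgue n)
      = (\<integral>\<^sup>+x. ennreal (exp (Rn_inner n x (\<lambda>i. ?c * \<theta> i / 8))) * Lp_weight n p x \<partial>Rn_lebesgue n)"
    by (simp add: Rn_inner_def sum_distrib_left sum_divide_distrib mult_ac)
  also have "\<dots> = (\<Prod>i<n. \<integral>\<^sup>+t. ennreal (exp (?c * \<theta> i * t / 8)) * exp_powr_weight p t \<partial>lborel)"
    by (simp add: nn_integral_exp_inner_Lp_weight)
  also have "\<dots> \<le> (\<Prod>i<n. ennreal (exp (3 * u powr \<alpha> * (\<theta> i)\<^sup>2)) * exp_powr_mass p)"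
    using \<alpha> u abs_le_one_of_unit[OF \<theta>] by (intro prod_mono_ennreal exp_powr_mgf) auto
  also have "\<dots> = ennreal (\<Prod>i<n. exp (3 * u powr \<alpha> * (\<theta> i)\<^sup>2)) * exp_powr_mass p ^ n"
    by (simp add: prod.distrib prod_ennreal)
  also have "(\<Prod>i<n. exp (3 * u powr \<alpha> * (\<theta> i)\<^sup>2)) = exp (3 * u powr \<alpha>)"
    using \<theta> by (simp add: exp_sum[symmetric] sum_distrib_left[symmetric] Rn_inner_def power2_eq_square)
  finally show ?thesis .
qed

text \<open>Chernoff's bound on the layer \<open>k \<le> \<bar>y\<bar> / 48 < k + 1\<close>, summed over the layers, with the
  Laplace variable of the \<open>k\<close>-th layer chosen as in \<open>exp_powr_mgf\<close>.\<close>

lemma exp_powr_le_sum_exp_linear: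
  fixes y :: real
  assumes \<alpha>: "1 \<le> \<alpha>" "\<alpha> \<le> 2"
  shows "ennreal (exp (\<bar>y / 192\<bar> powr \<alpha>)) \<le> ennreal (21 / 16) +
    (\<Sum>j. ennreal (exp (- 5 * real (Suc j) powr \<alpha>)) *
      (ennreal (exp (real (Suc j) powr (\<alpha> - 1) * y / 8)) + ennreal (exp (real (Suc j) powr (\<alpha> - 1) * (- y) / 8))))"
    (is "_ \<le> _ + (\<Sum>j. ?t j)")
proof (cases "\<bar>y\<bar> < 48")
  case True
  \<comment> \<open>In the central layer |y / 192| <= 1/4, and exp (1/4) <= 1 + 1/4 + 1/16 =
    21/16.\<close>
  then have "\<bar>y / 192\<bar> powr \<alpha> \<le> (1 / 4) powr \<alpha>"
    using \<alpha> by (intro powr_mono2) auto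
  also have "\<dots> \<le> (1 / 4) powr 1"
    using \<alpha> by (intro powr_mono') auto
  finally have "exp (\<bar>y / 192\<bar> powr \<alpha>) \<le> exp (1 / 4)"
    by simp
  also have "\<dots> \<le> 21 / 16"
    using exp_bound[of "1 / 4"] by (simp add: power2_eq_square)
  finally show ?thesis
    by (intro add_increasing2 ennreal_leI) auto
next
  case False
  \<comment> \<open>The series is indexed from 0 and the layers from 1, hence the shift: k = Suc j
    is the floor of |y| / 48.\<close>
  define j where "j = nat \<lfloor>\<bar>y\<bar> / 48\<rfloor> - 1"
  define k where "k = real (Suc j)"
  have "1 \<le> \<lfloor>\<bar>y\<bar> / 48\<rfloor>"
    using False by (simp add: le_floor_iff)
  then have k_eq: "k = of_int \<lfloor>\<bar>y\<bar> / 48\<rfloor>"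
    by (simp add: k_def j_def of_nat_diff)
  have k: "1 \<le> k" "k \<le> \<bar>y\<bar> / 48" "\<bar>y\<bar> / 48 < k + 1"
    unfolding k_eq using \<open>1 \<le> \<lfloor>\<bar>y\<bar> / 48\<rfloor>\<close> by linarith+
  \<comment> \<open>|y| / 192 < (k + 1) / 4 <= k.\<close>
  have "\<bar>y / 192\<bar> powr \<alpha> \<le> k powr \<alpha>"
    using k \<alpha> by (intro powr_mono2) auto
  also have "k powr \<alpha> = k powr (\<alpha> - 1) * k"
    using k by (simp add: powr_mult_base mult.commute)
  \<comment> \<open>Split 1 = -5 + 6: the bound 6 * k <= |y| / 8 is the layer condition k <= |y| /
    48, while -5 outweighs the 3 in the exponent of \<open>Lp_weight_mgf\<close>.\<close>
  also have "k powr (\<alpha> - 1) * k = - 5 * (k powr (\<alpha> - 1) * k) + k powr (\<alpha> - 1) * (6 * k)"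
    by simp
  also have "\<dots> \<le> - 5 * (k powr (\<alpha> - 1) * k) + k powr (\<alpha> - 1) * (\<bar>y\<bar> / 8)"
    using k by (intro add_left_mono mult_left_mono) auto
  also have "k powr (\<alpha> - 1) * k = k powr \<alpha>"
    using k by (simp add: powr_mult_base mult.commute)
  finally have "exp (\<bar>y / 192\<bar> powr \<alpha>) \<le> exp (- 5 * k powr \<alpha>) * exp (k powr (\<alpha> - 1) * \<bar>y\<bar> / 8)"
    by (simp add: mult_exp_exp)
  also have "\<dots> \<le> exp (- 5 * k powr \<alpha>) *
      (exp (k powr (\<alpha> - 1) * y / 8) + exp (k powr (\<alpha> - 1) * (- y) / 8))"
    by (intro mult_left_mono) (auto simp: abs_if)
  finally have "ennreal (exp (\<bar>y / 192\<bar> powr \<alpha>)) \<le> ?t j"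
    unfolding k_def[symmetric] by (simp add: ennreal_mult'[symmetric] ennreal_leI flip: ennreal_plus)
  also have "\<dots> = sum ?t {j}"
    by simp
  also have "\<dots> \<le> (\<Sum>j. ?t j)"
    by (rule sum_le_suminf) auto
  finally show ?thesis
    by (intro add_increasing) auto
qed

text \<open>k powr \<alpha> >= k makes the series geometric. The ratio is at most 1/5, since exp 2
  >= 1 + 2 + 2, and 2 * (1/5) / (1 - 1/5) = 1/2.\<close>

lemma suminf_exp_minus_powr_le:
  assumes \<alpha>: "1 \<le> \<alpha>"
  shows "(\<Sum>j. ennreal (2 * exp (- 2 * real (Suc j) powr \<alpha>))) \<le> ennreal (1 / 2)"
proof -
  have "(\<lambda>j. (1 / 5 :: real) ^ j) sums (1 / (1 - 1 / 5))"
    by (rule geometric_sums) simp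
  from sums_mult[OF this, of "2 / 5"] have sums: "(\<lambda>j. 2 * (1 / 5 :: real) ^ Suc j) sums (1 / 2)"
    by simp
  have "(\<Sum>j. ennreal (2 * exp (- 2 * real (Suc j) powr \<alpha>))) \<le> (\<Sum>j. ennreal (2 * (1 / 5) ^ Suc j))"
  proof (intro suminf_le ennreal_leI mult_left_mono)
    fix j
    have "real (Suc j) powr 1 \<le> real (Suc j) powr \<alpha>"
      using \<alpha> by (intro powr_mono) auto
    then have "exp (- 2 * real (Suc j) powr \<alpha>) \<le> exp (real (Suc j) * (- 2))"
      by simp
    also have "\<dots> = exp (- 2) ^ Suc j"
      by (rule exp_of_nat_mult)
    also have "\<dots> \<le> (1 / 5) ^ Suc j"
      using exp_lower_Taylor_quadratic[of 2]
      by (intro power_mono) (auto simp: exp_minus field_simps)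
    finally show "exp (- 2 * real (Suc j) powr \<alpha>) \<le> (1 / 5) ^ Suc j" .
  qed auto
  also have "\<dots> = ennreal (1 / 2)"
    using sums by (intro suminf_ennreal_eq) auto
  finally show ?thesis .
qed

lemma Lp_weight_psi_bound:
  assumes \<alpha>: "1 \<le> \<alpha>" "\<alpha> \<le> 2" "\<alpha> \<le> p" and \<theta>: "Rn_inner n \<theta> \<theta> = 1"
  shows "(\<integral>\<^sup>+x. ennreal (exp (\<bar>Rn_inner n x \<theta> / 192\<bar> powr \<alpha>)) * Lp_weight n p x \<partial>Rn_lebesgue n)
    \<le> 2 * exp_powr_mass p ^ n"
proof -
  let ?M = "Rn_lebesgue n" and ?W = "Lp_weight n p" and ?Z = "exp_powr_mass p ^ n"
  let ?f = "\<lambda>x. Rn_inner n x \<theta>"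
  define E where "E u y = ennreal (exp (u powr (\<alpha> - 1) * y / 8))" for u y :: real
  define b where "b j = ennreal (exp (- 5 * real (Suc j) powr \<alpha>))" for j
  have [measurable]: "(\<lambda>x. E u (?f x)) \<in> borel_measurable ?M"
    "(\<lambda>x. E u (- ?f x)) \<in> borel_measurable ?M" for u
    unfolding E_def by measurable
  have mgf: "(\<integral>\<^sup>+x. E u (?f x) * ?W x \<partial>?M) \<le> ennreal (exp (3 * u powr \<alpha>)) * ?Z"
    "(\<integral>\<^sup>+x. E u (- ?f x) * ?W x \<partial>?M) \<le> ennreal (exp (3 * u powr \<alpha>)) * ?Z" if "1 \<le> u" for u
    \<comment> \<open>The negative tail is the positive tail for the unit vector with coordinates -
      \<theta> i.\<close>
    using Lp_weight_mgf[OF \<alpha> that, of n \<theta>] Lp_weight_mgf[OF \<alpha> that, of n "\<lambda>i. - \<theta> i"] \<theta>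
    by (simp_all add: E_def Rn_inner_def sum_negf)
  have "(\<integral>\<^sup>+x. ennreal (exp (\<bar>?f x / 192\<bar> powr \<alpha>)) * ?W x \<partial>?M)
      \<le> (\<integral>\<^sup>+x. ennreal (21 / 16) * ?W x +
          (\<Sum>j. b j * (E (real (Suc j)) (?f x) * ?W x + E (real (Suc j)) (- ?f x) * ?W x)) \<partial>?M)"
  proof (rule nn_integral_mono)
    fix x
    from mult_right_mono[OF exp_powr_le_sum_exp_linear[OF \<alpha>(1,2), of "?f x"], of "?W x"]
    show "ennreal (exp (\<bar>?f x / 192\<bar> powr \<alpha>)) * ?W x \<le> ennreal (21 / 16) * ?W x +
          (\<Sum>j. b j * (E (real (Suc j)) (?f x) * ?W x + E (real (Suc j)) (- ?f x) * ?W x))"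
      by (simp add: E_def b_def distrib_right ennreal_suminf_multc[symmetric] mult.assoc)
  qed
  also have "\<dots> = ennreal (21 / 16) * ?Z + (\<Sum>j. b j *
      ((\<integral>\<^sup>+x. E (real (Suc j)) (?f x) * ?W x \<partial>?M) + (\<integral>\<^sup>+x. E (real (Suc j)) (- ?f x) * ?W x \<partial>?M)))"
    by (simp add: nn_integral_add nn_integral_cmult nn_integral_suminf nn_integral_Lp_weight_mass del: of_nat_Suc)
  also have "\<dots> \<le> ennreal (21 / 16) * ?Z + (\<Sum>j. ennreal (2 * exp (- 2 * real (Suc j) powr \<alpha>)) * ?Z)"
  proof (intro add_left_mono suminf_le)
    fix j
    define k where "k = real (Suc j)"
    have k: "1 \<le> k" and b: "b j = ennreal (exp (- 5 * k powr \<alpha>))"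
      by (simp_all add: k_def b_def)
    have "b j * ((\<integral>\<^sup>+x. E k (?f x) * ?W x \<partial>?M) + (\<integral>\<^sup>+x. E k (- ?f x) * ?W x \<partial>?M))
        \<le> b j * (ennreal (exp (3 * k powr \<alpha>)) * ?Z + ennreal (exp (3 * k powr \<alpha>)) * ?Z)"
      by (intro mult_left_mono add_mono mgf k) auto
    also have "\<dots> = b j * (2 * ennreal (exp (3 * k powr \<alpha>))) * ?Z"
      by (simp only: mult_2 distrib_right mult.assoc)
    also have "b j * (2 * ennreal (exp (3 * k powr \<alpha>)))
        = ennreal (exp (- 5 * k powr \<alpha>) * (2 * exp (3 * k powr \<alpha>)))"
      by (simp only: b ennreal_mult' ennreal_mult exp_ge_zero ennreal_numeral zero_le_numeral)
    \<comment> \<open>-5 from the layer weight plus 3 from the Laplace transform leaves decay rate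
      2.\<close>
    also have "exp (- 5 * k powr \<alpha>) * (2 * exp (3 * k powr \<alpha>)) = 2 * exp (- 2 * k powr \<alpha>)"
      by (simp add: mult_exp_exp)
    finally show "b j * ((\<integral>\<^sup>+x. E (real (Suc j)) (?f x) * ?W x \<partial>?M)
          + (\<integral>\<^sup>+x. E (real (Suc j)) (- ?f x) * ?W x \<partial>?M))
        \<le> ennreal (2 * exp (- 2 * real (Suc j) powr \<alpha>)) * ?Z"
      unfolding k_def .
  qed auto
  also have "\<dots> = (ennreal (21 / 16) + (\<Sum>j. ennreal (2 * exp (- 2 * real (Suc j) powr \<alpha>)))) * ?Z"
    by (simp add: ennreal_suminf_multc distrib_right)
  also have "\<dots> \<le> (ennreal (21 / 16) + ennreal (1 / 2)) * ?Z"
    using \<alpha> by (intro mult_right_mono add_left_mono suminf_exp_minus_powr_le) auto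
  also have "\<dots> \<le> ennreal 2 * ?Z"
  proof (rule mult_right_mono)
    have "ennreal (21 / 16) + ennreal (1 / 2) = ennreal (21 / 16 + 1 / 2)"
      by (rule ennreal_plus[symmetric]) auto
    also have "\<dots> \<le> ennreal 2"
      by (rule ennreal_leI) simp
    finally show "ennreal (21 / 16) + ennreal (1 / 2) \<le> ennreal 2" .
  qed simp
  finally show ?thesis by simp
qed

section \<open>Lower bound for second moments\<close>

lemma nn_integral_affine_square_exp_powr:
  "(\<integral>\<^sup>+t. ennreal ((a + b * t)\<^sup>2) * exp_powr_weight p t \<partial>lborel)
    = ennreal (a\<^sup>2) * exp_powr_mass p
      + ennreal (b\<^sup>2) * (\<integral>\<^sup>+t. ennreal (t\<^sup>2) * exp_powr_weight p t \<partial>lborel)" (is "?A = ?B")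
proof -
  \<comment> \<open>Reflection cancels the cross term 2 * a * b * t.\<close>
  have "2 * ?A = (\<integral>\<^sup>+t. (ennreal ((a + b * t)\<^sup>2) + ennreal ((a + b * (- t))\<^sup>2)) * exp_powr_weight p t \<partial>lborel)"
    by (rule nn_integral_exp_powr_weight_symmetrize) measurable
  also have "\<dots> = (\<integral>\<^sup>+t. 2 * (ennreal (a\<^sup>2) * exp_powr_weight p t
      + ennreal (b\<^sup>2) * (ennreal (t\<^sup>2) * exp_powr_weight p t)) \<partial>lborel)"
  proof (rule nn_integral_cong)
    fix t :: real
    have "ennreal ((a + b * t)\<^sup>2) + ennreal ((a + b * (- t))\<^sup>2) = ennreal (2 * (a\<^sup>2 + b\<^sup>2 * t\<^sup>2))"
      by (simp flip: ennreal_plus) (simp add: power2_eq_square algebra_simps)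
    also have "\<dots> = 2 * (ennreal (a\<^sup>2) + ennreal (b\<^sup>2) * ennreal (t\<^sup>2))"
      by (simp add: ennreal_mult')
    finally show "(ennreal ((a + b * t)\<^sup>2) + ennreal ((a + b * (- t))\<^sup>2)) * exp_powr_weight p t
      = 2 * (ennreal (a\<^sup>2) * exp_powr_weight p t + ennreal (b\<^sup>2) * (ennreal (t\<^sup>2) * exp_powr_weight p t))"
      by (simp add: distrib_right mult.assoc)
  qed
  also have "\<dots> = 2 * ?B"
    by (simp add: nn_integral_cmult nn_integral_add exp_powr_mass_def)
  finally show ?thesis
    by (subst (asm) ennreal_mult_cancel_left) auto
qed

text \<open>Induction on the coordinates: integrating out one of them, with the others fixed, adds
  its own variance and no cross term. Each variance is bounded below by
  \<open>exp_powr_mass_le_variance\<close>.\<close>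

lemma product_second_moment_lower:
  fixes I :: "nat set"
  assumes p: "1 \<le> p" and "finite I"
  shows "ennreal (\<Sum>i\<in>I. (\<theta> i)\<^sup>2) * exp_powr_mass p ^ card I
    \<le> 49 * (\<integral>\<^sup>+x. ennreal ((\<Sum>i\<in>I. \<theta> i * x i)\<^sup>2) * (\<Prod>i\<in>I. exp_powr_weight p (x i)) \<partial>Pi\<^sub>M I (\<lambda>_. lborel))"
  using \<open>finite I\<close>
proof induction
  case empty
  then show ?case by simp
next
  case (insert j I)
  let ?P = "Pi\<^sub>M I (\<lambda>_. lborel)" and ?w = "exp_powr_weight p" and ?Z = "exp_powr_mass p"
  let ?S = "\<lambda>x. \<Sum>i\<in>I. \<theta> i * x i" and ?W = "\<lambda>x. \<Prod>i\<in>I. exp_powr_weight p (x i)"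
  let ?V = "\<integral>\<^sup>+t. ennreal (t\<^sup>2) * exp_powr_weight p t \<partial>lborel"
  let ?A = "\<integral>\<^sup>+x. ennreal ((?S x)\<^sup>2) * ?W x \<partial>?P"
  have "(\<integral>\<^sup>+x. ennreal ((\<Sum>i\<in>insert j I. \<theta> i * x i)\<^sup>2) * (\<Prod>i\<in>insert j I. ?w (x i)) \<partial>Pi\<^sub>M (insert j I) (\<lambda>_. lborel))
      = (\<integral>\<^sup>+x. (\<integral>\<^sup>+y. ennreal ((\<Sum>i\<in>insert j I. \<theta> i * (x(j := y)) i)\<^sup>2)
          * (\<Prod>i\<in>insert j I. ?w ((x(j := y)) i)) \<partial>lborel) \<partial>?P)"
    using insert.hyps
    by (rule lborel_product.product_nn_integral_insert
        [where f = "\<lambda>x. ennreal ((\<Sum>i\<in>insert j I. \<theta> i * x i)\<^sup>2) * (\<Prod>i\<in>insert j I. ?w (x i))"]) measurable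
  also have "\<dots> = (\<integral>\<^sup>+x. (\<integral>\<^sup>+y. ennreal ((?S x + \<theta> j * y)\<^sup>2) * ?w y * ?W x \<partial>lborel) \<partial>?P)"
  proof (intro nn_integral_cong)
    fix x y
    have "(\<Sum>i\<in>I. \<theta> i * (x(j := y)) i) = ?S x" "(\<Prod>i\<in>I. ?w ((x(j := y)) i)) = ?W x"
      using insert.hyps by (auto intro!: sum.cong prod.cong)
    then show "ennreal ((\<Sum>i\<in>insert j I. \<theta> i * (x(j := y)) i)\<^sup>2) * (\<Prod>i\<in>insert j I. ?w ((x(j := y)) i))
        = ennreal ((?S x + \<theta> j * y)\<^sup>2) * ?w y * ?W x"
      using insert.hyps by (simp only: sum.insert prod.insert fun_upd_same mult.assoc add.commute simp_thms)
  qed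
  also have "\<dots> = (\<integral>\<^sup>+x. ?Z * (ennreal ((?S x)\<^sup>2) * ?W x) + ennreal ((\<theta> j)\<^sup>2) * ?V * ?W x \<partial>?P)"
  proof (rule nn_integral_cong)
    fix x
    have "(\<integral>\<^sup>+y. ennreal ((?S x + \<theta> j * y)\<^sup>2) * ?w y * ?W x \<partial>lborel)
        = (\<integral>\<^sup>+y. ennreal ((?S x + \<theta> j * y)\<^sup>2) * ?w y \<partial>lborel) * ?W x"
      by (rule nn_integral_multc) measurable
    also have "\<dots> = (ennreal ((?S x)\<^sup>2) * ?Z + ennreal ((\<theta> j)\<^sup>2) * ?V) * ?W x"
      by (simp only: nn_integral_affine_square_exp_powr)
    also have "\<dots> = ?Z * (ennreal ((?S x)\<^sup>2) * ?W x) + ennreal ((\<theta> j)\<^sup>2) * ?V * ?W x"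
      by (simp only: distrib_left distrib_right mult_ac)
    finally show "(\<integral>\<^sup>+y. ennreal ((?S x + \<theta> j * y)\<^sup>2) * ?w y * ?W x \<partial>lborel)
        = ?Z * (ennreal ((?S x)\<^sup>2) * ?W x) + ennreal ((\<theta> j)\<^sup>2) * ?V * ?W x" .
  qed
  also have "\<dots> = ?Z * ?A + ennreal ((\<theta> j)\<^sup>2) * ?V * (\<integral>\<^sup>+x. ?W x \<partial>?P)"
    by (simp add: nn_integral_add nn_integral_cmult)
  also have "(\<integral>\<^sup>+x. ?W x \<partial>?P) = ?Z ^ card I"
    using insert.hyps lborel_product.product_nn_integral_prod[of I "\<lambda>_. ?w"]
    by (simp add: exp_powr_mass_def)
  finally have eq: "49 * (\<integral>\<^sup>+x. ennreal ((\<Sum>i\<in>insert j I. \<theta> i * x i)\<^sup>2)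
      * (\<Prod>i\<in>insert j I. ?w (x i)) \<partial>Pi\<^sub>M (insert j I) (\<lambda>_. lborel))
      = ?Z * (49 * ?A) + ennreal ((\<theta> j)\<^sup>2) * (49 * ?V) * ?Z ^ card I"
    by (simp add: distrib_left mult_ac)
  have "ennreal (\<Sum>i\<in>insert j I. (\<theta> i)\<^sup>2) * ?Z ^ card (insert j I)
      = ?Z * (ennreal (\<Sum>i\<in>I. (\<theta> i)\<^sup>2) * ?Z ^ card I) + ennreal ((\<theta> j)\<^sup>2) * ?Z * ?Z ^ card I"
    using insert.hyps by (simp add: ennreal_plus sum_nonneg distrib_left distrib_right mult_ac add_ac)
  also have "\<dots> \<le> ?Z * (49 * ?A) + ennreal ((\<theta> j)\<^sup>2) * (49 * ?V) * ?Z ^ card I"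
    by (intro add_mono mult_left_mono mult_right_mono insert.IH exp_powr_mass_le_variance p) auto
  finally show ?case
    unfolding eq .
qed

lemma Lp_weight_second_moment_lower:
  assumes p: "1 \<le> p" and \<theta>: "Rn_inner n \<theta> \<theta> = 1"
  shows "exp_powr_mass p ^ n
    \<le> 49 * (\<integral>\<^sup>+x. ennreal ((Rn_inner n x \<theta>)\<^sup>2) * Lp_weight n p x \<partial>Rn_lebesgue n)"
  using product_second_moment_lower[OF p, of "{..<n}" \<theta>] \<theta>
  by (simp add: Rn_inner_def Lp_weight_eq_prod Rn_lebesgue_def power2_eq_square mult.commute)

section \<open>Transfer to the uniform measure\<close>

text \<open>Integrate the tangent line of exp at a * m against w. The negative part of the tangent
  is kept on the other side, and cancelled at the end because it is finite.\<close>

lemma exp_Jensen_weighted: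
  fixes s :: "'a \<Rightarrow> real"
  assumes [measurable]: "w \<in> borel_measurable N" "s \<in> borel_measurable N"
    and s: "\<And>t. 0 \<le> s t" and a: "0 \<le> a" and m: "0 \<le> m"
    and A: "A < \<infinity>" "(\<integral>\<^sup>+t. w t \<partial>N) = A" "(\<integral>\<^sup>+t. w t * ennreal (s t) \<partial>N) = A * ennreal m"
  shows "A * ennreal (exp (a * m)) \<le> (\<integral>\<^sup>+t. w t * ennreal (exp (a * s t)) \<partial>N)"
proof -
  let ?e = "ennreal (exp (a * m))" and ?J = "\<integral>\<^sup>+t. w t * ennreal (exp (a * s t)) \<partial>N"
  have "A * ?e + A * (?e * ennreal (a * m)) = (\<integral>\<^sup>+t. ?e * w t + ?e * ennreal a * (w t * ennreal (s t)) \<partial>N)"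
    using A(2,3) a by (simp add: nn_integral_add nn_integral_cmult) (simp add: ennreal_mult' mult_ac)
  also have "\<dots> \<le> (\<integral>\<^sup>+t. w t * ennreal (exp (a * s t)) + ?e * ennreal (a * m) * w t \<partial>N)"
  proof (rule nn_integral_mono)
    fix t
    have "exp (a * m) * (1 + (a * s t - a * m)) \<le> exp (a * m) * exp (a * s t - a * m)"
      by (intro mult_left_mono exp_ge_add_one_self) auto
    also have "\<dots> = exp (a * s t)"
      by (simp add: mult_exp_exp)
    finally have "exp (a * m) + exp (a * m) * a * s t \<le> exp (a * s t) + exp (a * m) * (a * m)"
      by (simp add: algebra_simps)
    from ennreal_leI[OF this]
    have "?e + ?e * ennreal a * ennreal (s t) \<le> ennreal (exp (a * s t)) + ?e * ennreal (a * m)"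
      using a m s by (simp add: ennreal_mult' ennreal_mult)
    from mult_left_mono[OF this, of "w t"]
    show "?e * w t + ?e * ennreal a * (w t * ennreal (s t)) \<le> w t * ennreal (exp (a * s t)) + ?e * ennreal (a * m) * w t"
      by (simp add: distrib_left mult_ac)
  qed
  also have "\<dots> = ?J + ?e * ennreal (a * m) * A"
    using A(2) by (simp add: nn_integral_add nn_integral_cmult)
  finally have "A * (?e * ennreal (a * m)) + A * ?e \<le> A * (?e * ennreal (a * m)) + ?J"
    by (simp add: mult_ac add_ac)
  moreover have "A * (?e * ennreal (a * m)) < \<infinity>"
    using A(1) by (simp add: ennreal_mult_less_top)
  ultimately show ?thesis
    by (auto simp: ennreal_add_left_cancel_le)
qed

text \<open>The q-th moment of a gamma variable of parameter s.\<close>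

definition Gamma_ratio :: "real \<Rightarrow> real \<Rightarrow> real" where
  "Gamma_ratio s q = Gamma (s + q) / Gamma s"

lemma Gamma_ratio_pos: "0 < s \<Longrightarrow> 0 \<le> q \<Longrightarrow> 0 < Gamma_ratio s q"
  by (simp add: Gamma_ratio_def Gamma_real_pos)

lemma Gamma_plus1_pos:
  fixes s :: real
  assumes "0 < s"
  shows "Gamma (s + 1) = s * Gamma s"
  using assms by (intro Gamma_plus1) (auto elim!: nonpos_Ints_cases)

lemma Gamma_ratio_1: "0 < s \<Longrightarrow> Gamma_ratio s 1 = s"
  using Gamma_real_pos[of s] by (simp add: Gamma_ratio_def Gamma_plus1_pos less_imp_neq[symmetric])

text \<open>Log-convexity of Gamma between s + 1 and s + 2 gives the bound s * (s + 1) powr (q - 1).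
  Replacing s + 1 by 2 * s costs 2 powr (q - 1) <= 2.\<close>

lemma Gamma_ratio_le:
  assumes s: "1 \<le> s" and q: "1 \<le> q" "q \<le> 2"
  shows "Gamma_ratio s q \<le> 2 * s powr q"
proof -
  have pos: "0 < Gamma s" "0 < Gamma (s + 1)" "0 < Gamma (s + 2)" "0 < Gamma (s + q)"
    using s q by (auto intro!: Gamma_real_pos)
  have G1: "Gamma (s + 1) = s * Gamma s" and G2: "Gamma (s + 2) = (s + 1) * (s * Gamma s)"
    using Gamma_plus1_pos[of s] Gamma_plus1_pos[of "s + 1"] s by (auto simp: add.assoc)
  have "ln (Gamma ((1 - (q - 1)) *\<^sub>R (s + 1) + (q - 1) *\<^sub>R (s + 2)))
      \<le> (1 - (q - 1)) * ln (Gamma (s + 1)) + (q - 1) * ln (Gamma (s + 2))"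
    using convex_onD[OF log_convex_Gamma_real, of "q - 1" "s + 1" "s + 2"] s q by simp
  also have "(1 - (q - 1)) *\<^sub>R (s + 1) + (q - 1) *\<^sub>R (s + 2) = s + q"
    by (simp add: algebra_simps)
  also have "(1 - (q - 1)) * ln (Gamma (s + 1)) + (q - 1) * ln (Gamma (s + 2))
      = ln (s * Gamma s) + (q - 1) * ln (s + 1)"
  proof -
    have s0: "0 < s" "0 < s + 1" using s by auto
    have "ln (Gamma (s + 2)) = ln (s + 1) + ln (s * Gamma s)"
      unfolding G2 by (rule ln_mult_pos) (use s0 pos in simp_all)
    then show ?thesis
      unfolding G1 by (simp add: left_diff_distrib right_diff_distrib distrib_left)
  qed
  also have "\<dots> = ln (s * Gamma s * (s + 1) powr (q - 1))"
  proof -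
    have "ln (s * Gamma s * (s + 1) powr (q - 1)) = ln (s * Gamma s) + ln ((s + 1) powr (q - 1))"
      by (rule ln_mult_pos) (use s pos in simp_all)
    then show ?thesis
      using s by (simp add: ln_powr)
  qed
  finally have "Gamma (s + q) \<le> s * Gamma s * (s + 1) powr (q - 1)"
    using s pos by simp
  then have "Gamma_ratio s q \<le> s * (s + 1) powr (q - 1)"
    using pos by (simp add: Gamma_ratio_def field_simps)
  also have "\<dots> \<le> s * (2 * s) powr (q - 1)"
    using s q by (intro mult_left_mono powr_mono2) auto
  also have "\<dots> = 2 powr (q - 1) * s powr q"
    using s by (simp add: powr_mult powr_mult_base)
  also have "\<dots> \<le> 2 powr 1 * s powr q"
    using q by (intro mult_right_mono powr_mono) auto
  finally show ?thesis by simp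
qed

section \<open>Comparison of the ball with the product density\<close>

context
  fixes n :: nat and p :: real
  assumes p: "1 \<le> p"
begin

abbreviation (input) shape :: real where "shape \<equiv> real n / p + 1"

lemma shape_pos: "0 < shape"
  using p by (intro add_nonneg_pos) auto

lemma Gamma_shape_pos: "0 < Gamma shape"
  using shape_pos by (rule Gamma_real_pos)

lemma nn_integral_gamma_weight_powr:
  assumes "0 \<le> q"
  shows "(\<integral>\<^sup>+t. gamma_weight (n / p) t * ennreal (t powr q) \<partial>lborel)
    = ennreal (Gamma shape) * ennreal (Gamma_ratio shape q)"
proof -
  have "0 \<le> real n / p" using p by simp
  with assms have a: "-1 < real n / p + q" by linarith
  have "ennreal (Gamma shape) * ennreal (Gamma_ratio shape q) = ennreal (Gamma (n / p + q + 1))"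
    using Gamma_shape_pos by (simp add: ennreal_mult'[symmetric] Gamma_ratio_def add_ac)
  then show ?thesis
    unfolding gamma_weight_times_powr nn_integral_gamma_weight[OF a] by simp
qed

lemma nn_integral_gamma_weight_mass:
  "(\<integral>\<^sup>+t. gamma_weight (n / p) t \<partial>lborel) = ennreal (Gamma shape)"
proof (rule nn_integral_gamma_weight)
  have "0 \<le> real n / p" using p by simp
  then show "- 1 < real n / p" by linarith
qed

text \<open>The level-set formula for the constant function 1; this is the classical volume formula
  for the ball.\<close>

lemma emeasure_Lp_ball:
  "ennreal (Gamma shape) * emeasure (Rn_lebesgue n) (Lp_ball n p) = exp_powr_mass p ^ n"
  using nn_integral_Lp_weight[of p "\<lambda>_. 1" n] p
  by (simp add: nn_integral_Lp_weight_mass nn_integral_gamma_weight_mass nn_integral_multc mult.commute)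

lemma emeasure_Lp_ball_pos_finite:
  "emeasure (Rn_lebesgue n) (Lp_ball n p) \<noteq> 0" "emeasure (Rn_lebesgue n) (Lp_ball n p) \<noteq> \<infinity>"
proof -
  let ?v = "emeasure (Rn_lebesgue n) (Lp_ball n p)"
  have Z: "exp_powr_mass p ^ n \<noteq> 0" "exp_powr_mass p ^ n \<noteq> \<infinity>"
    using exp_powr_mass_pos[OF p] exp_powr_mass_less_top[OF p] by (auto simp: power_eq_top_ennreal)
  show "?v \<noteq> 0"
    using emeasure_Lp_ball Z(1) by auto
  show "?v \<noteq> \<infinity>"
    using emeasure_Lp_ball Z(2) Gamma_shape_pos by (auto simp: ennreal_mult_top)
qed

lemma Rn_inner_scale: "Rn_inner n (Rn_scale n c x) \<theta> = c * Rn_inner n x \<theta>"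
  by (simp add: Rn_inner_def Rn_scale_def sum_distrib_left mult.assoc)

text \<open>Jensen is applied in t for each fixed x: the radial factor enters as t powr (\<alpha> /
  p), whose mean is the Gamma ratio in the exponent.\<close>

lemma psi_moment_Lp_ball:
  assumes \<alpha>: "1 \<le> \<alpha>" "\<alpha> \<le> 2" "\<alpha> \<le> p" and \<theta>: "Rn_inner n \<theta> \<theta> = 1"
  shows "(\<integral>\<^sup>+x. ennreal (exp (\<bar>Rn_inner n x \<theta> / 192\<bar> powr \<alpha> * Gamma_ratio shape (\<alpha> / p))) * indicator (Lp_ball n p) x
      \<partial>Rn_lebesgue n) \<le> 2 * emeasure (Rn_lebesgue n) (Lp_ball n p)" (is "?I \<le> 2 * ?v")
proof -
  let ?M = "Rn_lebesgue n" and ?f = "\<lambda>x. Rn_inner n x \<theta>"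
  let ?a = "\<lambda>x. \<bar>Rn_inner n x \<theta> / 192\<bar> powr \<alpha>" and ?m = "Gamma_ratio shape (\<alpha> / p)"
  have q: "0 \<le> \<alpha> / p" using \<alpha> p by simp
  have m: "0 \<le> ?m"
    using Gamma_ratio_pos[OF shape_pos q] by (rule less_imp_le)
  have "ennreal (Gamma shape) * ?I
      = (\<integral>\<^sup>+x. ennreal (Gamma shape) * (ennreal (exp (?a x * ?m)) * indicator (Lp_ball n p) x) \<partial>?M)"
    by (rule nn_integral_cmult[symmetric]) measurable
  also have "\<dots> \<le> (\<integral>\<^sup>+x. indicator (Lp_ball n p) x *
        (\<integral>\<^sup>+t. gamma_weight (n / p) t * ennreal (exp (\<bar>?f (Rn_scale n (t powr (1 / p)) x) / 192\<bar> powr \<alpha>)) \<partial>lborel) \<partial>?M)"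
  proof (rule nn_integral_mono)
    fix x
    have "ennreal (Gamma shape) * ennreal (exp (?a x * ?m))
        \<le> (\<integral>\<^sup>+t. gamma_weight (n / p) t * ennreal (exp (?a x * t powr (\<alpha> / p))) \<partial>lborel)"
      using m nn_integral_gamma_weight_mass nn_integral_gamma_weight_powr[OF q]
      by (intro exp_Jensen_weighted) auto
    also have "\<dots> = (\<integral>\<^sup>+t. gamma_weight (n / p) t * ennreal (exp (\<bar>?f (Rn_scale n (t powr (1 / p)) x) / 192\<bar> powr \<alpha>)) \<partial>lborel)"
    proof (rule nn_integral_cong)
      fix t :: real
      have "\<bar>?f (Rn_scale n (t powr (1 / p)) x) / 192\<bar> powr \<alpha> = ?a x * t powr (\<alpha> / p)"
        by (simp add: Rn_inner_scale abs_mult powr_mult powr_powr powr_divide mult.commute)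
      then show "gamma_weight (n / p) t * ennreal (exp (?a x * t powr (\<alpha> / p)))
          = gamma_weight (n / p) t * ennreal (exp (\<bar>?f (Rn_scale n (t powr (1 / p)) x) / 192\<bar> powr \<alpha>))"
        by simp
    qed
    finally show "ennreal (Gamma shape) * (ennreal (exp (?a x * ?m)) * indicator (Lp_ball n p) x)
        \<le> indicator (Lp_ball n p) x *
        (\<integral>\<^sup>+t. gamma_weight (n / p) t * ennreal (exp (\<bar>?f (Rn_scale n (t powr (1 / p)) x) / 192\<bar> powr \<alpha>)) \<partial>lborel)"
      by (simp add: indicator_def)
  qed
  also have "\<dots> = (\<integral>\<^sup>+x. ennreal (exp (\<bar>?f x / 192\<bar> powr \<alpha>)) * Lp_weight n p x \<partial>?M)"
    using p by (intro nn_integral_Lp_weight[symmetric]) auto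
  also have "\<dots> \<le> 2 * exp_powr_mass p ^ n"
    by (rule Lp_weight_psi_bound[OF \<alpha> \<theta>])
  also have "\<dots> = ennreal (Gamma shape) * (2 * ?v)"
    by (simp add: emeasure_Lp_ball[symmetric] mult_ac)
  finally show ?thesis
    using Gamma_shape_pos by (simp add: ennreal_mult_le_mult_iff)
qed

text \<open>The square is homogeneous, so here the radial factor t powr (2 / p) integrates out
  exactly.\<close>

lemma second_moment_Lp_ball_lower:
  assumes \<theta>: "Rn_inner n \<theta> \<theta> = 1"
  shows "emeasure (Rn_lebesgue n) (Lp_ball n p) \<le> ennreal (49 * Gamma_ratio shape (2 / p)) *
    (\<integral>\<^sup>+x. ennreal ((Rn_inner n x \<theta>)\<^sup>2) * indicator (Lp_ball n p) x \<partial>Rn_lebesgue n)" (is "?v \<le> _ * ?I")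
proof -
  let ?M = "Rn_lebesgue n" and ?f = "\<lambda>x. Rn_inner n x \<theta>" and ?m = "Gamma_ratio shape (2 / p)"
  have "ennreal (Gamma shape) * ?v = exp_powr_mass p ^ n"
    by (rule emeasure_Lp_ball)
  also have "\<dots> \<le> 49 * (\<integral>\<^sup>+x. ennreal ((?f x)\<^sup>2) * Lp_weight n p x \<partial>?M)"
    by (rule Lp_weight_second_moment_lower[OF p \<theta>])
  also have "(\<integral>\<^sup>+x. ennreal ((?f x)\<^sup>2) * Lp_weight n p x \<partial>?M)
      = (\<integral>\<^sup>+x. indicator (Lp_ball n p) x *
        (\<integral>\<^sup>+t. gamma_weight (n / p) t * ennreal ((?f (Rn_scale n (t powr (1 / p)) x))\<^sup>2) \<partial>lborel) \<partial>?M)"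
    using p by (intro nn_integral_Lp_weight) auto
  also have "\<dots> = (\<integral>\<^sup>+x. ennreal (Gamma shape) * ennreal ?m * (ennreal ((?f x)\<^sup>2) * indicator (Lp_ball n p) x) \<partial>?M)"
  proof (rule nn_integral_cong)
    fix x
    have "(\<integral>\<^sup>+t. gamma_weight (n / p) t * ennreal ((?f (Rn_scale n (t powr (1 / p)) x))\<^sup>2) \<partial>lborel)
        = (\<integral>\<^sup>+t. gamma_weight (n / p) t * ennreal (t powr (2 / p)) * ennreal ((?f x)\<^sup>2) \<partial>lborel)"
    proof (rule nn_integral_cong)
      fix t :: real
      have "(?f (Rn_scale n (t powr (1 / p)) x))\<^sup>2 = t powr (2 / p) * (?f x)\<^sup>2"
        by (simp add: Rn_inner_scale power_mult_distrib power2_eq_square[of "t powr (1 / p)"] flip: powr_add)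
      then show "gamma_weight (n / p) t * ennreal ((?f (Rn_scale n (t powr (1 / p)) x))\<^sup>2)
          = gamma_weight (n / p) t * ennreal (t powr (2 / p)) * ennreal ((?f x)\<^sup>2)"
        by (simp add: ennreal_mult' mult.assoc)
    qed
    also have "\<dots> = (\<integral>\<^sup>+t. gamma_weight (n / p) t * ennreal (t powr (2 / p)) \<partial>lborel) * ennreal ((?f x)\<^sup>2)"
      by (rule nn_integral_multc) measurable
    also have "\<dots> = ennreal (Gamma shape) * ennreal ?m * ennreal ((?f x)\<^sup>2)"
      using p by (subst nn_integral_gamma_weight_powr) auto
    finally show "indicator (Lp_ball n p) x *
        (\<integral>\<^sup>+t. gamma_weight (n / p) t * ennreal ((?f (Rn_scale n (t powr (1 / p)) x))\<^sup>2) \<partial>lborel)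
        = ennreal (Gamma shape) * ennreal ?m * (ennreal ((?f x)\<^sup>2) * indicator (Lp_ball n p) x)"
      by (simp add: indicator_def)
  qed
  also have "\<dots> = ennreal (Gamma shape) * ennreal ?m * ?I"
    by (rule nn_integral_cmult) measurable
  also have "49 * (ennreal (Gamma shape) * ennreal ?m * ?I) = ennreal (Gamma shape) * (ennreal (49 * ?m) * ?I)"
    by (simp add: ennreal_mult' mult_ac)
  finally show ?thesis
    using Gamma_shape_pos by (simp add: ennreal_mult_le_mult_iff)
qed

lemma psi_norm_Lp_ball_le:
  assumes \<alpha>: "1 \<le> \<alpha>" "\<alpha> \<le> 2" "\<alpha> \<le> p" and \<theta>: "Rn_inner n \<theta> \<theta> = 1"
  shows "psi_norm \<alpha> (uniform_on_body n (Lp_ball n p)) (\<lambda>x. Rn_inner n x \<theta>)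
    \<le> ennreal (192 / Gamma_ratio shape (\<alpha> / p) powr (1 / \<alpha>))"
proof -
  let ?M = "Rn_lebesgue n" and ?f = "\<lambda>x. Rn_inner n x \<theta>" and ?m = "Gamma_ratio shape (\<alpha> / p)"
  let ?v = "emeasure ?M (Lp_ball n p)"
  have m: "0 < ?m"
    using \<alpha> p by (intro Gamma_ratio_pos shape_pos) auto
  \<comment> \<open>Scales 192 so that the Gamma ratio from Jensen's inequality is absorbed into the
    \<alpha>-th power.\<close>
  define r where "r = 192 / ?m powr (1 / \<alpha>)"
  have r: "0 < r"
    using m by (simp add: r_def)
  have eq: "\<bar>?f x / r\<bar> powr \<alpha> = \<bar>?f x / 192\<bar> powr \<alpha> * ?m" for x
    using m \<alpha> by (simp add: r_def abs_mult powr_mult powr_powr powr_divide)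
  have "(\<integral>\<^sup>+x. ennreal (exp (\<bar>?f x / r\<bar> powr \<alpha>)) \<partial>uniform_on_body n (Lp_ball n p))
      = (\<integral>\<^sup>+x. ennreal (exp (\<bar>?f x / r\<bar> powr \<alpha>)) * indicator (Lp_ball n p) x \<partial>?M) / ?v"
    unfolding uniform_on_body_def by (rule nn_integral_uniform_measure) measurable
  also have "\<dots> \<le> 2 * ?v / ?v"
    unfolding eq by (intro divide_right_mono_ennreal psi_moment_Lp_ball assms)
  also have "\<dots> = 2"
    using emeasure_Lp_ball_pos_finite by (intro ennreal_mult_divide_eq) auto
  finally have "ennreal r \<in> ennreal ` {r. 0 < r \<and>
      (\<integral>\<^sup>+x. ennreal (exp (\<bar>?f x / r\<bar> powr \<alpha>)) \<partial>uniform_on_body n (Lp_ball n p)) \<le> 2}"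
    using r by blast
  then show ?thesis
    unfolding psi_norm_def r_def by (rule Inf_lower)
qed

text \<open>7 is the square root of the variance constant 49. If the square were not integrable,
  \<open>L2_norm\<close> would be infinite by definition.\<close>

lemma L2_norm_Lp_ball_ge:
  assumes \<theta>: "Rn_inner n \<theta> \<theta> = 1"
  shows "ennreal (1 / (7 * sqrt (Gamma_ratio shape (2 / p))))
    \<le> L2_norm (uniform_on_body n (Lp_ball n p)) (\<lambda>x. Rn_inner n x \<theta>)"
proof (cases "integrable (uniform_on_body n (Lp_ball n p)) (\<lambda>x. \<bar>Rn_inner n x \<theta>\<bar>\<^sup>2)")
  case True
  let ?M = "Rn_lebesgue n" and ?f = "\<lambda>x. Rn_inner n x \<theta>" and ?m = "Gamma_ratio shape (2 / p)"
  let ?v = "emeasure ?M (Lp_ball n p)" and ?U = "uniform_on_body n (Lp_ball n p)"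
  let ?I = "\<integral>\<^sup>+x. ennreal ((?f x)\<^sup>2) * indicator (Lp_ball n p) x \<partial>?M"
  have m: "0 < ?m"
    using p by (intro Gamma_ratio_pos shape_pos) auto
  have "ennreal (\<integral>x. \<bar>?f x\<bar>\<^sup>2 \<partial>?U) = (\<integral>\<^sup>+x. ennreal ((?f x)\<^sup>2) \<partial>?U)"
    using True by (subst nn_integral_eq_integral[symmetric]) auto
  also have "\<dots> = ?I / ?v"
    unfolding uniform_on_body_def by (rule nn_integral_uniform_measure) measurable
  finally have var: "ennreal (\<integral>x. \<bar>?f x\<bar>\<^sup>2 \<partial>?U) = ?I / ?v" .
  have "1 = ?v / ?v"
    using emeasure_Lp_ball_pos_finite by (simp add: ennreal_divide_self less_top)
  also have "\<dots> \<le> ennreal (49 * ?m) * ?I / ?v"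
    by (intro divide_right_mono_ennreal second_moment_Lp_ball_lower \<theta>)
  also have "\<dots> = ennreal (49 * ?m * (\<integral>x. \<bar>?f x\<bar>\<^sup>2 \<partial>?U))"
  proof -
    have "ennreal (49 * ?m) * ?I / ?v = ennreal (49 * ?m) * ennreal (\<integral>x. \<bar>?f x\<bar>\<^sup>2 \<partial>?U)"
      unfolding var by (rule ennreal_times_divide[symmetric])
    also have "\<dots> = ennreal (49 * ?m * (\<integral>x. \<bar>?f x\<bar>\<^sup>2 \<partial>?U))"
      by (rule ennreal_mult'[symmetric]) (use m in simp)
    finally show ?thesis .
  qed
  finally have "1 \<le> 49 * ?m * (\<integral>x. \<bar>?f x\<bar>\<^sup>2 \<partial>?U)"
    by simp
  then have "1 / (49 * ?m) \<le> (\<integral>x. \<bar>?f x\<bar>\<^sup>2 \<partial>?U)"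
    using m by (simp add: field_simps)
  then have "sqrt (1 / (49 * ?m)) \<le> sqrt (\<integral>x. \<bar>?f x\<bar>\<^sup>2 \<partial>?U)"
    by (rule real_sqrt_le_mono)
  moreover have "sqrt (1 / (49 * ?m)) = 1 / (7 * sqrt ?m)"
    using real_sqrt_abs[of 7] by (simp add: real_sqrt_divide real_sqrt_mult)
  ultimately show ?thesis
    using True by (simp add: L2_norm_def ennreal_leI)
qed (simp add: L2_norm_def)

lemma psi_body_Lp_ball:
  assumes n: "1 \<le> n" and \<alpha>: "1 \<le> \<alpha>" "\<alpha> \<le> 2" "\<alpha> \<le> p"
    and ratio: "Gamma_ratio shape (2 / p) \<le> 2 * Gamma_ratio shape (\<alpha> / p) powr (2 / \<alpha>)"
  shows "psi_body n \<alpha> 2688 (Lp_ball n p)"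
  unfolding psi_body_def psi_direction_def
proof (intro conjI ballI Lp_ball_convex_body Lp_ball_centered p n)
  fix \<theta> assume "\<theta> \<in> Rn_unit_sphere n"
  then have \<theta>: "Rn_inner n \<theta> \<theta> = 1"
    by (simp add: Rn_unit_sphere_def)
  let ?m = "Gamma_ratio shape (\<alpha> / p)" and ?m2 = "Gamma_ratio shape (2 / p)"
  have m: "0 < ?m" "0 < ?m2"
    using \<alpha> p by (auto intro!: Gamma_ratio_pos shape_pos)
  \<comment> \<open>The factor 2 is relaxed to 4, so that the right-hand side is a perfect
    square.\<close>
  have "?m2 \<le> 4 * ?m powr (2 / \<alpha>)"
    using ratio powr_ge_zero[of ?m "2 / \<alpha>"] by linarith
  also have "\<dots> = (2 * ?m powr (1 / \<alpha>))\<^sup>2"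
    by (simp add: power_mult_distrib power2_eq_square flip: powr_add)
  finally have "sqrt ?m2 \<le> 2 * ?m powr (1 / \<alpha>)"
    by (intro real_le_lsqrt) auto
  \<comment> \<open>2688 = 192 * 7 * 2: exponential moment, variance and radial comparison.\<close>
  then have "192 / ?m powr (1 / \<alpha>) \<le> 2688 * (1 / (7 * sqrt ?m2))"
    using m by (simp add: field_simps)
  then have "ennreal (192 / ?m powr (1 / \<alpha>)) \<le> ennreal 2688 * ennreal (1 / (7 * sqrt ?m2))"
    by (subst ennreal_mult'[symmetric]) (auto intro!: ennreal_leI)
  also have "\<dots> \<le> ennreal 2688 * L2_norm (uniform_on_body n (Lp_ball n p)) (\<lambda>x. Rn_inner n x \<theta>)"
    by (intro mult_left_mono L2_norm_Lp_ball_ge \<theta>) simp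
  finally show "psi_norm \<alpha> (uniform_on_body n (Lp_ball n p)) (\<lambda>x. Rn_inner n x \<theta>)
      \<le> ennreal 2688 * L2_norm (uniform_on_body n (Lp_ball n p)) (\<lambda>x. Rn_inner n x \<theta>)"
    using psi_norm_Lp_ball_le[OF \<alpha> \<theta>] by (rule order_trans[rotated])
qed

end

theorem proposition10:
  shows "\<exists>C::real. C > 0 \<and>
    (\<forall>n::nat. \<forall>p::real. n \<ge> 1 \<longrightarrow> p \<ge> 2 \<longrightarrow> psi_body n 2 C (Lp_ball n p)) \<and>
    (\<forall>n::nat. \<forall>p::real. n \<ge> 1 \<longrightarrow> 1 \<le> p \<longrightarrow> p \<le> 2 \<longrightarrow> psi_body n p C (Lp_ball n p))"
proof (intro exI[of _ 2688] conjI allI impI)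
  fix n :: nat and p :: real
  assume n: "n \<ge> 1" and p: "p \<ge> 2"
  \<comment> \<open>For \<alpha> = 2 both radial moments coincide, so the ratio condition is
    immediate.\<close>
  have "0 < Gamma_ratio (real n / p + 1) (2 / p)"
    using p by (intro Gamma_ratio_pos add_nonneg_pos) simp_all
  then have "Gamma_ratio (real n / p + 1) (2 / p) \<le> 2 * Gamma_ratio (real n / p + 1) (2 / p) powr (2 / 2)"
    by simp
  from psi_body_Lp_ball[OF _ n _ _ _ this] p show "psi_body n 2 2688 (Lp_ball n p)"
    by simp
next
  fix n :: nat and p :: real
  assume n: "n \<ge> 1" and p: "1 \<le> p" "p \<le> 2"
  \<comment> \<open>For \<alpha> = p the moment of order \<alpha> / p = 1 is the gamma parameter
    itself, and 2 / p lies in [1, 2].\<close>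
  have "Gamma_ratio (real n / p + 1) (2 / p) \<le> 2 * (real n / p + 1) powr (2 / p)"
  proof (rule Gamma_ratio_le)
    show "1 \<le> 2 / p" "2 / p \<le> 2" "1 \<le> real n / p + 1"
      using p by (simp_all add: field_simps)
  qed
  moreover have "Gamma_ratio (real n / p + 1) (p / p) = real n / p + 1"
    using p by (simp add: Gamma_ratio_1 add_nonneg_pos)
  ultimately have "Gamma_ratio (real n / p + 1) (2 / p)
      \<le> 2 * Gamma_ratio (real n / p + 1) (p / p) powr (2 / p)"
    by (simp only:)
  from psi_body_Lp_ball[OF _ n _ _ _ this] p show "psi_body n p 2688 (Lp_ball n p)"
    by simp
qed simp

end
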